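(* Let $f$ be as in the context (asymptotically quasi-homogeneous of type $\alpha=(0,\alpha_1,\dots,\alpha_n)$ and order $k+1$, satisfying assumption (R)). Let $(t_\ast,\mathbf Y_{0,\ast})$ with $\mathbf Y_{0,\ast}=(Y_{0,1},\dots,Y_{0,n})^T\neq\mathbf 0$ be a root of the balance law $$-\frac1k\Lambda_\alpha\mathbf Y_{0,\ast}+f_{\alpha,k}(t_\ast,\mathbf Y_{0,\ast})=0 .$$ Assume that ${\rm Spec}(A)\cap i\mathbb R=\emptyset$, where $A=-\frac1k\Lambda_\alpha+D_{\mathbf y}f_{\alpha,k}(t_\ast,\mathbf Y_{0,\ast})$. Then the ODE $\mathbf y'=f(t,\mathbf y)$ admits a blow-up solution $\mathbf y(t)$ blowing up as $t\to t_\ast-0$. Moreover, if $f$ is $C^4$ and ${\rm Spec}(A^{\rm ext})$ satisfies the non-resonance condition, the corresponding blow-up solution admits the asymptotic behavior $$y_i(t)\sim Y_{0,i}\,\theta(t)^{-\alpha_i/k}\quad\text{as } t\to t_{\max}-0,\qquad \theta(t)=t_{\max}-t,\quad t_{\max}=t_\ast<\infty,$$ for every $i$ with $Y_{0,i}\neq0$.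
   Context: $n\ge1$, $f:\mathbb R\times\tilde U\to\mathbb R^n$ is $C^r$, $r\ge1$. Let $\alpha=(0,\alpha_1,\dots,\alpha_n)$ be nonnegative integers, not all zero, $I_\alpha=\{i:\alpha_i>0\}$, $\Lambda_\alpha={\rm diag}(\alpha_1,\dots,\alpha_n)$, $\Lambda_\alpha^{\rm ext}={\rm diag}(0,\alpha_1,\dots,\alpha_n)$, $s^{\Lambda_\alpha}={\rm diag}(s^{\alpha_1},\dots,s^{\alpha_n})$. $\tilde U$ is the set of $\mathbf y$ with $y_i\in\mathbb R$ arbitrary for $i\in I_\alpha$ and the remaining coordinates in some open set. $f$ is asymptotically quasi-homogeneous of type $\alpha$ and order $k+1$ ($k>0$): there is $f_{\alpha,k}=(f_{1;\alpha,k},\dots,f_{n;\alpha,k})$ with $f_{i;\alpha,k}(t,s^{\Lambda_\alpha}\mathbf y)=s^{k+\alpha_i}f_{i;\alpha,k}(t,\mathbf y)$ for all $s>0$, and $f_i(t,s^{\Lambda_\alpha}\mathbf y)-s^{k+\alpha_i}f_{i;\alpha,k}(t,\mathbf y)=o(s^{k+\alpha_i})$ as $s\to\infty$, uniformly on $\sum_{i\in I_\alpha}y_i^2=1$ with $t$ and the coordinates $y_j$, $j\notin I_\alpha$, in any compact set. Put $f_{i;\rm res}=f_i-f_{i;\alpha,k}$ and $f^{\rm ext}_{\alpha,k}=(0,f_{\alpha,k})^T$. Derivatives of $f_{\alpha,k}$ used are understood to exist and be continuous. Let $c$ be the least common multiple of $\alpha_i$ ($i\in I_\alpha$), $\beta_i=c/\alpha_i$,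 $p_\alpha(\mathbf x)=(\sum_{i\in I_\alpha}x_i^{2\beta_i})^{1/2c}$, $\kappa_\alpha(\mathbf x)=(1-p_\alpha(\mathbf x)^{2c})^{-1}$, and for $p_\alpha(\mathbf x)<1$ set $\tilde f_i(t,\mathbf x)=\kappa_\alpha^{-(k+\alpha_i)}f_i(t,\kappa_\alpha^{\Lambda_\alpha}\mathbf x)$ and $\tilde f_{i;\rm res}(t,\mathbf x)=\kappa_\alpha^{-(k+\alpha_i)}f_{i;\rm res}(t,\kappa_\alpha^{\Lambda_\alpha}\mathbf x)$; the functions $\tilde f_i$ are understood to extend to $\{p_\alpha(\mathbf x)\le1\}$ with the smoothness of $f$. The horizon is $\mathcal E=\{(t,\mathbf x):p_\alpha(\mathbf x)=1\}$. Assumption (R): $k\ge1$, and there is $\epsilon>0$ such that, as $(t,\mathbf x)$ approaches $\mathcal E$, $\tilde f_{i;\rm res}(t,\mathbf x)=O(\kappa_\alpha(\mathbf x)^{-(1+\epsilon)})$ and $\partial\tilde f_{i;\rm res}/\partial x_l(t,\mathbf x)=o(\kappa_\alpha(\mathbf x)^{1+\epsilon})$ for $i=1,\dots,n$, $l=0,\dots,n$ (with $x_0=t$). $A^{\rm ext}=-\frac1k\Lambda^{\rm ext}_\alpha+Df^{\rm ext}_{\alpha,k}(t_\ast,\mathbf Y_{0,\ast})=\begin{pmatrix}0&\mathbf 0^T\\ D_tf_{\alpha,k}(t_\ast,\mathbf Y_{0,\ast})&A\end{pmatrix}$. Non-resonance condition: writing ${\rm Spec}(A^{\rm ext})\setminus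 i\mathbb R=\{\lambda_1,\dots,\lambda_n\}$ (with multiplicity), $a_1\lambda_1+\cdots+a_n\lambda_n-\lambda_j\neq0$ for every $j\in\{1,\dots,n\}$ and every $(a_1,\dots,a_n)\in\mathbb Z_{>0}^n$ with $\sum_ja_j\ge2$. A solution blows up at $t_{\max}<\infty$ if its norm diverges as $t\to t_{\max}-0$. $h_1\sim h_2$ means $h_1/h_2\to1$. *)

theory Defs
  imports
    "HOL-Analysis.Analysis"
    "HOL-Library.Landau_Symbols"
    "HOL-Computational_Algebra.Polynomial"
begin

subsection \<open>Functions of class \<open>C\<^sup>r\<close>\<close>

text \<open>Intended for open sets \<open>S\<close> of a finite-dimensional space, where continuity of all directional
  derivatives up to order \<open>r\<close> is continuity of the derivatives up to order \<open>r\<close>.\<close>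

primrec C_r_on :: "nat \<Rightarrow> ('a::real_normed_vector \<Rightarrow> 'b::real_normed_vector) \<Rightarrow> 'a set \<Rightarrow> bool" where
  "C_r_on 0 f S \<longleftrightarrow> continuous_on S f"
| "C_r_on (Suc r) f S \<longleftrightarrow>
     (\<forall>x\<in>S. f differentiable (at x)) \<and> (\<forall>v. C_r_on r (\<lambda>x. frechet_derivative f (at x) v) S)"

subsection \<open>Spectrum of a real matrix\<close>

definition complex_mat :: "real ^ 'n ^ 'm \<Rightarrow> complex ^ 'n ^ 'm" where
  "complex_mat A = (\<chi> i j. complex_of_real (A $ i $ j))"

definition Spec :: "real ^ 'n ^ 'n \<Rightarrow> complex set" where
  "Spec A = {z. \<exists>v. v \<noteq> 0 \<and> complex_mat A *v v = z *s v}"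

definition charpoly :: "real ^ 'n ^ 'n \<Rightarrow> complex poly" where
  "charpoly A = det (\<chi> i j. (if i = j then [:0, 1:] else 0) - [:complex_mat A $ i $ j:])"

text \<open>The eigenvalues repeated according to their algebraic multiplicity.\<close>

definition Spec_mset :: "real ^ 'n ^ 'n \<Rightarrow> complex multiset" where
  "Spec_mset A = proots (charpoly A)"

lemma poly_charpoly: "poly (charpoly A) z = det (mat z - complex_mat A)"
proof -
  have "poly (of_int (sign p)) z = (of_int (sign p) :: complex)" for p :: "'a \<Rightarrow> 'a"
    by (simp add: sign_def)
  then show ?thesis
    unfolding charpoly_def det_def
    by (auto simp: poly_sum poly_prod mat_def intro!: sum.cong prod.cong)
qed

lemma poly_charpoly_eq_0_iff: "poly (charpoly A) z = 0 \<longleftrightarrow> z \<in> Spec A"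
proof -
  have *: "(mat z - complex_mat A) *v v = z *s v - complex_mat A *v v" for v
  proof -
    have "mat z *v v = z *s v"
      by (simp add: vec_eq_iff matrix_vector_mult_def mat_def if_distrib [of "\<lambda>u. u * _"] cong: if_cong)
    then show ?thesis
      by (simp add: matrix_vector_mult_diff_rdistrib)
  qed
  have "poly (charpoly A) z = 0 \<longleftrightarrow> \<not> invertible (mat z - complex_mat A)"
    by (simp add: poly_charpoly invertible_det_nz)
  also have "\<dots> \<longleftrightarrow> (\<exists>v. v \<noteq> 0 \<and> (mat z - complex_mat A) *v v = 0)"
    by (auto simp: invertible_left_inverse matrix_left_invertible_ker)
  also have "\<dots> \<longleftrightarrow> z \<in> Spec A"
    unfolding Spec_def * by auto
  finally show ?thesis .
qed

subsection \<open>Type, scaling and compactification\<close>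

text \<open>The type \<open>(0, \<alpha>\<^sub>1, \<dots>, \<alpha>\<^sub>n)\<close> is given by its nontrivial part \<open>\<alpha> :: 'n \<Rightarrow> nat\<close>.\<close>

definition I_of :: "('n \<Rightarrow> nat) \<Rightarrow> 'n set" where
  "I_of \<alpha> = {i. \<alpha> i > 0}"

definition Lam :: "('n \<Rightarrow> nat) \<Rightarrow> real ^ 'n ^ 'n" where
  "Lam \<alpha> = (\<chi> i j. if i = j then real (\<alpha> i) else 0)"

text \<open>\<open>s_Lam \<alpha> s y\<close> is \<open>s\<close> to the power \<open>\<Lambda>\<^sub>\<alpha>\<close>, applied to \<open>y\<close>.\<close>

definition s_Lam :: "('n \<Rightarrow> nat) \<Rightarrow> real \<Rightarrow> real ^ 'n \<Rightarrow> real ^ 'n" where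
  "s_Lam \<alpha> s y = (\<chi> i. s ^ \<alpha> i * y $ i)"

text \<open>\<open>U\<close> is open and a full cylinder in the coordinates from \<open>I_of \<alpha>\<close>, i.e. it consists of all
  points whose remaining coordinates lie in some open set.\<close>

definition cylinder_domain :: "('n::finite \<Rightarrow> nat) \<Rightarrow> (real ^ 'n) set \<Rightarrow> bool" where
  "cylinder_domain \<alpha> U \<longleftrightarrow>
     open U \<and> (\<forall>y\<in>U. \<forall>z. (\<forall>j. j \<notin> I_of \<alpha> \<longrightarrow> z $ j = y $ j) \<longrightarrow> z \<in> U)"

definition c_of :: "('n \<Rightarrow> nat) \<Rightarrow> nat" where
  "c_of \<alpha> = Lcm (\<alpha> ` I_of \<alpha>)"

definition beta :: "('n \<Rightarrow> nat) \<Rightarrow> 'n \<Rightarrow> nat" where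
  "beta \<alpha> i = c_of \<alpha> div \<alpha> i"

definition p_fun :: "('n::finite \<Rightarrow> nat) \<Rightarrow> real ^ 'n \<Rightarrow> real" where
  "p_fun \<alpha> x = (\<Sum>i\<in>I_of \<alpha>. (x $ i) ^ (2 * beta \<alpha> i)) powr (1 / (2 * real (c_of \<alpha>)))"

definition kappa :: "('n::finite \<Rightarrow> nat) \<Rightarrow> real ^ 'n \<Rightarrow> real" where
  "kappa \<alpha> x = inverse (1 - p_fun \<alpha> x ^ (2 * c_of \<alpha>))"

text \<open>\<open>tilde \<alpha> k h\<close> is the transform \<open>h \<mapsto> h\<close>-tilde; it is only meaningful for \<open>p_fun \<alpha> x < 1\<close>.\<close>

definition tilde ::
  "('n::finite \<Rightarrow> nat) \<Rightarrow> real \<Rightarrow> (real \<times> (real ^ 'n) \<Rightarrow> real ^ 'n) \<Rightarrow> real \<times> (real ^ 'n) \<Rightarrow> real ^ 'n" where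
  "tilde \<alpha> k h = (\<lambda>(t, x).
     \<chi> i. kappa \<alpha> x powr (- (k + real (\<alpha> i))) * h (t, s_Lam \<alpha> (kappa \<alpha> x) x) $ i)"

definition inner_region :: "('n::finite \<Rightarrow> nat) \<Rightarrow> (real ^ 'n) set \<Rightarrow> (real \<times> (real ^ 'n)) set" where
  "inner_region \<alpha> U = {(t, x). x \<in> U \<and> p_fun \<alpha> x < 1}"

definition horizon :: "('n::finite \<Rightarrow> nat) \<Rightarrow> (real ^ 'n) set \<Rightarrow> (real \<times> (real ^ 'n)) set" where
  "horizon \<alpha> U = {(t, x). x \<in> U \<and> p_fun \<alpha> x = 1}"

subsection \<open>Hypotheses on the vector field\<close>

text \<open>\<open>fk\<close> plays the role of \<open>f\<^bsub>\<alpha>,k\<^esub>\<close>.\<close>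

definition asymp_quasi_homogeneous ::
  "('n::finite \<Rightarrow> nat) \<Rightarrow> real \<Rightarrow> (real ^ 'n) set \<Rightarrow>
   (real \<times> (real ^ 'n) \<Rightarrow> real ^ 'n) \<Rightarrow> (real \<times> (real ^ 'n) \<Rightarrow> real ^ 'n) \<Rightarrow> bool" where
  "asymp_quasi_homogeneous \<alpha> k U f fk \<longleftrightarrow>
     k > 0 \<and>
     (\<forall>t. \<forall>y\<in>U. \<forall>s>0. \<forall>i.
        fk (t, s_Lam \<alpha> s y) $ i = s powr (k + real (\<alpha> i)) * fk (t, y) $ i) \<and>
     (\<forall>T K i. compact T \<and> compact K \<and> K \<subseteq> {y \<in> U. (\<Sum>j\<in>I_of \<alpha>. (y $ j)\<^sup>2) = 1} \<longrightarrow>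
        uniform_limit (T \<times> K)
          (\<lambda>s (t, y). (f (t, s_Lam \<alpha> s y) $ i - s powr (k + real (\<alpha> i)) * fk (t, y) $ i)
                        / s powr (k + real (\<alpha> i)))
          (\<lambda>_. 0) at_top)"

text \<open>Being \<open>C\<^sup>r\<close> on the non-open set \<open>p_fun \<alpha> x \<le> 1\<close> means having a \<open>C\<^sup>r\<close> extension to an open
  neighbourhood of it.\<close>

definition tilde_extends :: "nat \<Rightarrow> ('n::finite \<Rightarrow> nat) \<Rightarrow> real \<Rightarrow> (real ^ 'n) set \<Rightarrow>
   (real \<times> (real ^ 'n) \<Rightarrow> real ^ 'n) \<Rightarrow> bool" where
  "tilde_extends r \<alpha> k U f \<longleftrightarrow>
     (\<exists>W F. open W \<and> inner_region \<alpha> U \<union> horizon \<alpha> U \<subseteq> W \<and> C_r_on r F W \<and>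
        (\<forall>z\<in>inner_region \<alpha> U. F z = tilde \<alpha> k f z))"

definition partial_t :: "(real \<times> (real ^ 'n::finite) \<Rightarrow> real) \<Rightarrow> real \<times> (real ^ 'n) \<Rightarrow> real" where
  "partial_t g = (\<lambda>(t, x). deriv (\<lambda>s. g (s, x)) t)"

definition partial_x :: "'n \<Rightarrow> (real \<times> (real ^ 'n::finite) \<Rightarrow> real) \<Rightarrow> real \<times> (real ^ 'n) \<Rightarrow> real" where
  "partial_x l g = (\<lambda>(t, x). deriv (\<lambda>s. g (t, \<chi> m. if m = l then s else x $ m)) (x $ l))"

text \<open>The orders as \<open>(t, x)\<close> approaches the horizon are understood locally uniformly, i.e. near
  each of its points, with the same exponent \<open>\<epsilon>\<close> everywhere.\<close>

definition assumption_R ::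
  "('n::finite \<Rightarrow> nat) \<Rightarrow> real \<Rightarrow> (real ^ 'n) set \<Rightarrow>
   (real \<times> (real ^ 'n) \<Rightarrow> real ^ 'n) \<Rightarrow> (real \<times> (real ^ 'n) \<Rightarrow> real ^ 'n) \<Rightarrow> bool" where
  "assumption_R \<alpha> k U f fk \<longleftrightarrow>
     k \<ge> 1 \<and>
     (\<exists>\<epsilon>>0. \<forall>z\<in>horizon \<alpha> U. \<forall>i.
        let F = at z within inner_region \<alpha> U;
            res = (\<lambda>w. tilde \<alpha> k (\<lambda>w. f w - fk w) w $ i)
        in res \<in> O[F](\<lambda>(t, x). kappa \<alpha> x powr (- (1 + \<epsilon>))) \<and>
           partial_t res \<in> o[F](\<lambda>(t, x). kappa \<alpha> x powr (1 + \<epsilon>)) \<and>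
           (\<forall>l. partial_x l res \<in> o[F](\<lambda>(t, x). kappa \<alpha> x powr (1 + \<epsilon>))))"

subsection \<open>The matrices \<open>A\<close> and \<open>A\<^sup>e\<^sup>x\<^sup>t\<close>\<close>

definition A_mat :: "('n::finite \<Rightarrow> nat) \<Rightarrow> real \<Rightarrow> (real \<times> (real ^ 'n) \<Rightarrow> real ^ 'n) \<Rightarrow>
   real \<Rightarrow> real ^ 'n \<Rightarrow> real ^ 'n ^ 'n" where
  "A_mat \<alpha> k fk t Y = (- 1 / k) *\<^sub>R Lam \<alpha> + jacobian (\<lambda>y. fk (t, y)) (at Y)"

text \<open>Extended vectors \<open>(t, y)\<close> are indexed by \<open>'n option\<close>; \<open>None\<close> is the index \<open>0\<close> of \<open>t\<close>.\<close>

definition ext_type :: "('n \<Rightarrow> nat) \<Rightarrow> 'n option \<Rightarrow> nat" where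
  "ext_type \<alpha> = case_option 0 \<alpha>"

definition ext_vec :: "real \<Rightarrow> real ^ 'n \<Rightarrow> real ^ ('n option)" where
  "ext_vec t y = (\<chi> m. case_option t (\<lambda>i. y $ i) m)"

definition ext_field :: "(real \<times> (real ^ 'n) \<Rightarrow> real ^ 'n) \<Rightarrow> real ^ ('n option) \<Rightarrow> real ^ ('n option)" where
  "ext_field h z = ext_vec 0 (h (z $ None, \<chi> i. z $ Some i))"

definition A_ext :: "('n::finite \<Rightarrow> nat) \<Rightarrow> real \<Rightarrow> (real \<times> (real ^ 'n) \<Rightarrow> real ^ 'n) \<Rightarrow>
   real \<Rightarrow> real ^ 'n \<Rightarrow> real ^ ('n option) ^ ('n option)" where
  "A_ext \<alpha> k fk t Y = (- 1 / k) *\<^sub>R Lam (ext_type \<alpha>) + jacobian (ext_field fk) (at (ext_vec t Y))"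

text \<open>The exponents \<open>a j\<close> are positive, not merely nonnegative as in Poincare's classical condition.\<close>

definition non_resonant :: "real ^ ('n::finite option) ^ ('n option) \<Rightarrow> bool" where
  "non_resonant B \<longleftrightarrow>
     (\<exists>lam :: 'n \<Rightarrow> complex.
        image_mset lam (mset_set UNIV) = filter_mset (\<lambda>z. Re z \<noteq> 0) (Spec_mset B) \<and>
        (\<forall>(a :: 'n \<Rightarrow> nat) j. (\<forall>i. a i > 0) \<and> (\<Sum>i\<in>UNIV. a i) \<ge> 2 \<longrightarrow>
           (\<Sum>i\<in>UNIV. of_nat (a i) * lam i) - lam j \<noteq> 0))"

subsection \<open>Blow-up solutions\<close>

definition blow_up_solution ::
  "(real \<times> (real ^ 'n::finite) \<Rightarrow> real ^ 'n) \<Rightarrow> (real ^ 'n) set \<Rightarrow> (real \<Rightarrow> real ^ 'n) \<Rightarrow> real \<Rightarrow> bool" where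
  "blow_up_solution f U y tmax \<longleftrightarrow>
     (\<exists>t0<tmax. \<forall>t\<in>{t0<..<tmax}. y t \<in> U \<and> (y has_vector_derivative f (t, y t)) (at t)) \<and>
     filterlim (\<lambda>t. norm (y t)) at_top (at_left tmax)"

end

theory Submission
  imports Defs "HOL-Computational_Algebra.Fundamental_Theorem_Algebra"
begin

text \<open>
  Write \<open>\<theta> = tstar - t\<close>, \<open>\<tau> = - ln \<theta>\<close> and \<open>\<sigma> = \<theta> powr (1 / k)\<close>. A solution has the expected blow-up
  profile if \<open>y = s_Lam \<alpha> (1 / \<sigma>) Y\<close> with \<open>Y\<close> tending to \<open>Y0\<close>, and in terms of \<open>Y\<close> and \<open>\<tau>\<close> the equation is

    \<open>Y' = - \<Lambda> Y / k + V(\<sigma>, t, Y)\<close>, where \<open>V\<^sub>i(\<sigma>, t, Y) = \<sigma> powr (k + \<alpha>\<^sub>i) f\<^sub>i(t, s_Lam \<alpha> (1 / \<sigma>) Y)\<close>.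

  As \<open>\<tau>\<close> tends to infinity, \<open>\<sigma>\<close> tends to \<open>0\<close>, \<open>t\<close> to \<open>tstar\<close>, and \<open>V\<close> to \<open>fk(tstar, Y)\<close>. So the equation is
  asymptotically autonomous, the balance law says that \<open>Y0\<close> is an equilibrium of the limit, and \<open>A\<close> is the
  linearization there. What has to be found is one solution that tends to this hyperbolic equilibrium.
  Both the blow-up and the asymptotics of the components with \<open>Y0 $ i \<noteq> 0\<close> then follow from \<open>Y \<longlongrightarrow> Y0\<close>; the norm
  diverges because \<open>Y0\<close> has a nonzero component with positive weight, for otherwise \<open>Y0\<close> would
  be in the kernel of \<open>A\<close> (\<open>hyperbolic_root_p_fun_pos\<close>).

  The solution is a fixed point of a contraction (\<open>hyperbolic_asymptotic_equilibrium\<close>). This needs two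
  ingredients. One is a bounded operator that solves \<open>z' = A z + h\<close> among the bounded functions
  on the line and preserves convergence to \<open>0\<close> (\<open>hyperbolic_bounded_solution_operator\<close>); it is composed of
  scalar convolution operators, one for each root of an annihilating polynomial of \<open>A\<close>.

  The other is that the difference between \<open>V\<close> and its linear part at \<open>Y0\<close> has a small Lipschitz constant in \<open>Y\<close>,
  uniformly for late times. Here the compactification enters. The transform of \<open>f\<close> has a \<open>C\<^sup>1\<close>
  extension \<open>F\<close> across the horizon, and \<open>V(\<sigma>, t, Y)\<close> is an elementary expression in \<open>F\<close>, evaluated at the
  compactified coordinate of \<open>s_Lam \<alpha> (1 / \<sigma>) Y\<close>, which itself extends differentiably to \<open>\<sigma> = 0\<close>
  (\<open>horizon_inverse_function\<close>). So \<open>V\<close> is strictly differentiable at \<open>(0, tstar, Y0)\<close>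
  (\<open>strictly_differentiable_rescaled_field\<close>). Since \<open>F = fk\<close> on the horizon by assumption (R)
  (\<open>extension_eq_on_horizon\<close>), \<open>V(0, t, Y) = fk(t, Y)\<close>, and the \<open>Y\<close>-derivative at that point is the one
  in \<open>A\<close>. Strict differentiability is exactly the required Lipschitz estimate.
\<close>

section \<open>Bounded solutions of scalar linear equations\<close>

lemma norm_vector_smult: "norm (c *s v) = cmod c * norm v" for v :: "complex ^ 'n"
  by (simp add: norm_vec_def norm_mult L2_set_right_distrib)

lemma bounded_bilinear_vector_smult: "bounded_bilinear ((*s) :: complex \<Rightarrow> complex ^ 'n \<Rightarrow> complex ^ 'n)"
proof
  show "\<exists>K. \<forall>a (b :: complex ^ 'n). norm (a *s b) \<le> norm a * norm b * K"
    by (rule exI[of _ 1]) (simp add: norm_vector_smult)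
qed (auto simp: vec_eq_iff algebra_simps)

lemmas bounded_linear_vector_smult = bounded_bilinear.bounded_linear_right[OF bounded_bilinear_vector_smult]

text \<open>Green's function of \<open>d/dt - l\<close> on the whole line: the exponential is cut off on the side on
  which it grows.\<close>

definition green :: "complex \<Rightarrow> real \<Rightarrow> complex" where
  "green l s = (if Re l < 0 then (if 0 \<le> s then exp (l * of_real s) else 0)
                else (if s < 0 then - exp (l * of_real s) else 0))"

lemma borel_measurable_green [measurable]: "green l \<in> borel_measurable borel"
  unfolding green_def by measurable

lemma integrable_exp_mult_atLeast:
  assumes "a < (0::real)"
  shows "integrable lborel (\<lambda>s. indicator {0..} s *\<^sub>R exp (a * s))"
proof (rule integrableI_nonneg)
  have lim: "((\<lambda>s. exp (a * s) / a) \<longlongrightarrow> 0) at_top"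
  proof -
    have "filterlim (\<lambda>s. a * s) at_bot at_top"
      using assms by (intro filterlim_tendsto_neg_mult_at_bot[OF tendsto_const]) (auto simp: filterlim_ident)
    then have "((\<lambda>s. exp (a * s)) \<longlongrightarrow> 0) at_top"
      by (rule filterlim_compose[OF exp_at_bot])
    then show ?thesis by (rule tendsto_divide_zero)
  qed
  have "(\<integral>\<^sup>+x. ennreal (exp (a * x)) * indicator {0..} x \<partial>lborel) = 0 - exp (a * 0) / a"
    by (rule nn_integral_FTC_atLeast[OF _ _ _ lim]) (use assms in \<open>auto intro!: derivative_eq_intros\<close>)
  also have "(\<integral>\<^sup>+x. ennreal (exp (a * x)) * indicator {0..} x \<partial>lborel) =
      (\<integral>\<^sup>+x. ennreal (indicator {0..} x *\<^sub>R exp (a * x)) \<partial>lborel)"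
    by (auto intro!: nn_integral_cong simp: indicator_def)
  finally show "(\<integral>\<^sup>+x. ennreal (indicator {0..} x *\<^sub>R exp (a * x)) \<partial>lborel) < \<infinity>"
    by simp
qed auto

lemma integrable_green:
  assumes "Re l \<noteq> 0"
  shows "integrable lborel (green l)"
proof (cases "Re l < 0")
  case True
  have "integrable lborel (\<lambda>s. indicator {0..} s *\<^sub>R exp (Re l * s))"
    using True by (rule integrable_exp_mult_atLeast)
  then show ?thesis
    by (rule Bochner_Integration.integrable_bound)
       (use True in \<open>auto simp: green_def indicator_def\<close>)
next
  case False
  with assms have "- Re l < 0" by simp
  then have "integrable lborel (\<lambda>s. indicator {0..} s *\<^sub>R exp (- Re l * s))"
    by (rule integrable_exp_mult_atLeast)
  then have "integrable lborel (\<lambda>s. indicator {0..} (0 + (-1) * s) *\<^sub>R exp (- Re l * (0 + (-1) * s)))"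
    by (rule lborel_integrable_real_affine) simp
  then show ?thesis
    by (rule Bochner_Integration.integrable_bound)
       (use False in \<open>auto simp: green_def indicator_def\<close>)
qed

text \<open>Inverting \<open>d/dt - l\<close> by a convolution on the whole line, instead of by an initial value problem,
  gives an operator without boundary terms that treats stable and unstable eigenvalues alike.\<close>

definition bounded_solution :: "complex \<Rightarrow> (real \<Rightarrow> complex ^ 'n) \<Rightarrow> real \<Rightarrow> complex ^ 'n" where
  "bounded_solution l h t = (LINT s|lborel. green l s *s h (t - s))"

definition green_norm :: "complex \<Rightarrow> real" where
  "green_norm l = (LINT s|lborel. norm (green l s))"

context
  fixes l :: complex and h :: "real \<Rightarrow> complex ^ 'n"
  assumes l: "Re l \<noteq> 0" and h_cont: "continuous_on UNIV h"
begin

lemma borel_h[measurable]: "h \<in> borel_measurable borel"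
  by (rule borel_measurable_continuous_onI[OF h_cont])

lemma borel_smult: "f \<in> borel_measurable borel \<Longrightarrow> g \<in> borel_measurable borel \<Longrightarrow>
    (\<lambda>x. f x *s g x) \<in> borel_measurable borel" for f :: "real \<Rightarrow> complex" and g :: "real \<Rightarrow> complex ^ 'n"
  by (rule borel_measurable_continuous_Pair)
     (auto intro!: bounded_bilinear.continuous_on[OF bounded_bilinear_vector_smult] continuous_intros)

lemma green_smult_integrable:
  assumes "\<And>s. norm (h s) \<le> M"
  shows "integrable lborel (\<lambda>s. green l s *s h (t - s))"
proof (rule Bochner_Integration.integrable_bound)
  show "integrable lborel (\<lambda>s. M * norm (green l s))"
    using integrable_green[OF l] by simp
  show "(\<lambda>s. green l s *s h (t - s)) \<in> borel_measurable lborel"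
    unfolding measurable_lborel2 by (rule borel_smult) measurable
  have M: "0 \<le> M" using norm_ge_zero[of "h 0"] assms[of 0] by linarith
  show "AE s in lborel. norm (green l s *s h (t - s)) \<le> norm (M * norm (green l s))"
    using assms M by (auto simp: norm_vector_smult abs_mult mult.commute[of M] intro!: mult_left_mono)
qed

lemma norm_bounded_solution_le:
  assumes "\<And>s. norm (h s) \<le> M"
  shows "norm (bounded_solution l h t) \<le> green_norm l * M"
proof -
  have "norm (bounded_solution l h t) \<le> (LINT s|lborel. norm (green l s *s h (t - s)))"
    unfolding bounded_solution_def by (rule integral_norm_bound)
  also have "\<dots> \<le> (LINT s|lborel. norm (green l s) * M)"
    using integrable_norm[OF green_smult_integrable[OF assms]] integrable_green[OF l] assms
    by (intro integral_mono) (auto simp: norm_vector_smult intro!: mult_left_mono)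
  finally show ?thesis by (simp add: green_norm_def)
qed

text \<open>Dominated convergence under the convolution integral: for fixed \<open>s\<close>, \<open>h (t - s)\<close> tends to \<open>0\<close>.\<close>

lemma bounded_solution_tendsto_0:
  assumes "\<And>s. norm (h s) \<le> M" and "(h \<longlongrightarrow> 0) at_top"
  shows "(bounded_solution l h \<longlongrightarrow> 0) at_top"
proof -
  have M: "0 \<le> M" using norm_ge_zero[of "h 0"] assms(1)[of 0] by linarith
  have "((\<lambda>t. LINT s|lborel. green l s *s h (t - s)) \<longlongrightarrow> (LINT s|(lborel :: real measure). (0 :: complex ^ 'n))) at_top"
  proof (rule integral_dominated_convergence_at_top[where s = "\<lambda>t s. green l s *s h (t - s)" and f = "\<lambda>_. 0" and M = lborel and w = "\<lambda>s. M * norm (green l s)"])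
    show "integrable lborel (\<lambda>s. M * norm (green l s))"
      using integrable_green[OF l] by simp
    show "\<forall>\<^sub>F t in at_top. AE s in lborel. norm (green l s *s h (t - s)) \<le> M * norm (green l s)"
      using assms(1) by (auto simp: norm_vector_smult mult.commute[of M] intro!: mult_left_mono always_eventually)
    show "AE s in lborel. ((\<lambda>t. green l s *s h (t - s)) \<longlongrightarrow> 0) at_top"
    proof (rule AE_I2)
      fix s :: real
      have "filterlim (\<lambda>t. t - s) at_top at_top"
        using filterlim_tendsto_add_at_top[OF tendsto_const[of "-s"] filterlim_ident] by simp
      then have "((\<lambda>t. h (t - s)) \<longlongrightarrow> 0) at_top"
        by (rule filterlim_compose[OF assms(2)])
      then show "((\<lambda>t. green l s *s h (t - s)) \<longlongrightarrow> 0) at_top"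
        using bounded_linear.tendsto_zero[OF bounded_linear_vector_smult] by blast
    qed
  next
    show "(\<lambda>s. green l s *s h (t - s)) \<in> borel_measurable lborel" for t
      unfolding measurable_lborel2 by (rule borel_smult) measurable
  qed auto
  then show ?thesis
    by (simp add: bounded_solution_def[abs_def])
qed

text \<open>Substituting \<open>u = t - s\<close> turns the convolution, up to sign, into \<open>exp (l t)\<close> times the integral of
  \<open>exp (- l u) h u\<close> over a half-line with endpoint \<open>t\<close>; the product rule and the fundamental theorem
  of calculus do the rest.\<close>

lemma bounded_solution_has_vector_derivative:
  assumes hM: "\<And>s. norm (h s) \<le> M"
  shows "(bounded_solution l h has_vector_derivative (l *s bounded_solution l h t + h t)) (at t)"
proof -
  define e where "e u = exp (- l * of_real u) *s h u" for u
  have e_cont: "continuous_on S e" for S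
    unfolding e_def
    by (intro bounded_bilinear.continuous_on[OF bounded_bilinear_vector_smult] continuous_intros
        continuous_on_subset[OF h_cont]) auto
  define J where "J t u = green l (t - u) *s h u" for t u
  have sub: "bounded_solution l h t = (LINT u|lborel. J t u)"
    and J_int: "integrable lborel (J t)" for t
  proof -
    show "bounded_solution l h t = (LINT u|lborel. J t u)"
      unfolding bounded_solution_def J_def
      by (subst lborel_integral_real_affine[of "-1" _ t]) auto
    have "integrable lborel (\<lambda>s. green l (t + (-1) * s) *s h (t - (t + (-1) * s)))"
      by (rule lborel_integrable_real_affine[OF green_smult_integrable[OF hM]]) simp
    then show "integrable lborel (J t)"
      by (simp add: J_def[abs_def])
  qed
  define S where "S t = (if Re l < 0 then {..t} else {t<..})" for t :: real
  define g :: complex where "g = (if Re l < 0 then 1 else -1)"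
  have J_eq: "J t u = (g * exp (l * of_real t)) *s (indicator (S t) u *\<^sub>R e u)" for t u
    by (auto simp: J_def S_def g_def e_def green_def indicator_def vector_smult_assoc mult.assoc
          simp flip: exp_add simp: algebra_simps)
  have e_int: "set_integrable lborel (S t) e" for t
  proof -
    have "(inverse (g * exp (l * of_real t))) *s J t u = indicator (S t) u *\<^sub>R e u" for u
      unfolding J_eq by (simp add: vector_smult_assoc g_def)
    then show ?thesis
      unfolding set_integrable_def
      using integrable_bounded_linear[OF bounded_linear_vector_smult J_int[of t]]
      by (metis (no_types, lifting) Bochner_Integration.integrable_cong)
  qed
  define W where "W t = g *s (LINT u:S t|lborel. e u)" for t
  have sol: "bounded_solution l h t = exp (l * of_real t) *s W t" for t
  proof -
    have "bounded_solution l h t = (g * exp (l * of_real t)) *s (LINT u:S t|lborel. e u)"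
      unfolding sub J_eq set_lebesgue_integral_def
      by (rule integral_bounded_linear[OF bounded_linear_vector_smult])
         (use e_int in \<open>simp add: set_integrable_def\<close>)
    then show ?thesis by (simp add: W_def vector_smult_assoc mult.commute)
  qed
  \<comment> \<open>Near \<open>t\<close>, the half-line splits into a fixed part and the compact interval from \<open>a\<close>.\<close>
  define a where "a = t - 1"
  have ab_int: "set_integrable lborel {a..t'} e" for t'
    by (rule borel_integrable_atLeastAtMost') (rule e_cont)
  have "\<exists>C. \<forall>t'\<ge>a. W t' = C + integral {a..t'} e"
  proof (cases "Re l < 0")
    case True
    have "W t' = (LINT u:{..<a}|lborel. e u) + integral {a..t'} e" if "a \<le> t'" for t'
    proof -
      have eq: "{..t'} = {..<a} \<union> {a..t'}" using that by auto
      have i: "set_integrable lborel {..t'} e" using e_int[of t'] True by (simp add: S_def)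
      have "W t' = (LINT u:{..<a} \<union> {a..t'}|lborel. e u)"
        using True eq by (simp add: W_def g_def S_def)
      also have "\<dots> = (LINT u:{..<a}|lborel. e u) + (LINT u:{a..t'}|lborel. e u)"
        by (rule set_integral_Un[OF _ set_integrable_subset[OF i] ab_int]) (use that in auto)
      finally show ?thesis
        using set_borel_integral_eq_integral(2)[OF ab_int] by simp
    qed
    then show ?thesis by blast
  next
    case False
    have "W t' = - (LINT u:{a..}|lborel. e u) + integral {a..t'} e" if "a \<le> t'" for t'
    proof -
      have eq: "{a..} = {a..t'} \<union> {t'<..}" using that by auto
      have i: "set_integrable lborel {t'<..} e" using e_int[of t'] False by (simp add: S_def)
      have "(LINT u:{a..}|lborel. e u) = (LINT u:{a..t'}|lborel. e u) + (LINT u:{t'<..}|lborel. e u)"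
        unfolding eq by (rule set_integral_Un[OF _ ab_int i]) auto
      then show ?thesis
        using set_borel_integral_eq_integral(2)[OF ab_int] False by (simp add: W_def g_def S_def vector_sneg_minus1[symmetric])
    qed
    then show ?thesis by blast
  qed
  then obtain C where C: "\<And>t'. a \<le> t' \<Longrightarrow> W t' = C + integral {a..t'} e" by blast
  have "((\<lambda>u. integral {a..u} e) has_vector_derivative e t) (at t within {a..t + 1})"
    by (rule integral_has_vector_derivative[OF e_cont]) (simp add: a_def)
  then have "((\<lambda>u. integral {a..u} e) has_vector_derivative e t) (at t)"
    by (subst (asm) at_within_interior) (auto simp: a_def)
  then have "((\<lambda>u. C + integral {a..u} e) has_vector_derivative e t) (at t)"
    by (auto intro!: derivative_eq_intros)
  then have W': "(W has_vector_derivative e t) (at t)"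
    by (rule has_vector_derivative_transform_within_open[where S = "{a<..}"]) (auto simp: a_def C)
  have "((\<lambda>t. exp (l * of_real t)) has_vector_derivative (l * exp (l * of_real t))) (at t)"
    by (auto intro!: derivative_eq_intros has_vector_derivative_real_field simp: mult.commute)
  from bounded_bilinear.has_vector_derivative[OF bounded_bilinear_vector_smult this W']
  have "((\<lambda>t. exp (l * of_real t) *s W t) has_vector_derivative
      (exp (l * of_real t) *s e t + (l * exp (l * of_real t)) *s W t)) (at t)" .
  then have "(bounded_solution l h has_vector_derivative
      (exp (l * of_real t) *s e t + (l * exp (l * of_real t)) *s W t)) (at t)"
    by (simp add: sol[abs_def])
  moreover have "exp (l * of_real t) *s e t = h t"
    by (simp add: e_def vector_smult_assoc flip: exp_add)
  ultimately show ?thesis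
    by (simp add: sol vector_smult_assoc add.commute)
qed

end

section \<open>Annihilating polynomials of a matrix\<close>

definition mat_poly :: "complex ^ 'n ^ 'n \<Rightarrow> complex poly \<Rightarrow> complex ^ 'n ^ 'n" where
  "mat_poly B p = fold_coeffs (\<lambda>a M. mat a + B ** M) p 0"

lemma mat_poly_0 [simp]: "mat_poly B 0 = 0"
  by (simp add: mat_poly_def)

lemma mat_poly_pCons [simp]: "mat_poly B (pCons a p) = mat a + B ** mat_poly B p"
  by (cases "p = 0 \<and> a = 0") (auto simp: mat_poly_def vec_eq_iff matrix_matrix_mult_def)

lemma mat_add: "mat (a + b) = mat a + (mat b :: complex ^ 'n ^ 'n)"
  by (simp add: vec_eq_iff mat_def)

lemma mat_mult_component: "(mat c ** M) $ i $ j = c * M $ i $ j" for M :: "complex ^ 'm ^ 'n"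
  by (simp add: matrix_matrix_mult_def mat_def if_distrib [of "\<lambda>u. u * _"] cong: if_cong)

lemma mult_mat_component: "(M ** mat c) $ i $ j = c * M $ i $ j" for M :: "complex ^ 'n ^ 'm"
  by (simp add: matrix_matrix_mult_def mat_def if_distrib [of "\<lambda>u. _ * u"] mult.commute cong: if_cong)

lemma mat_mult_commute: "mat c ** M = M ** mat c" for M :: "complex ^ 'n ^ 'n"
  by (simp add: vec_eq_iff mat_mult_component mult_mat_component)

lemma mat_poly_add: "mat_poly B (p + q) = mat_poly B p + mat_poly B q"
  by (induction p q rule: poly_induct2) (simp_all add: mat_add matrix_add_ldistrib)

lemma mat_poly_smult: "mat_poly B (smult c p) = mat c ** mat_poly B p"
proof (induction p)
  case 0
  show ?case by (simp add: vec_eq_iff mat_mult_component)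
next
  case (pCons a p)
  have "mat (c * a) = mat c ** (mat a :: complex ^ 'b ^ 'b)"
    by (simp add: vec_eq_iff mat_mult_component) (simp add: mat_def)
  moreover have "B ** (mat c ** mat_poly B p) = mat c ** (B ** mat_poly B p)"
    by (metis mat_mult_commute matrix_mul_assoc)
  ultimately show ?case
    using pCons.IH by (simp add: matrix_add_ldistrib)
qed

lemma mat_poly_sum: "mat_poly B (\<Sum>i\<in>I. p i) = (\<Sum>i\<in>I. mat_poly B (p i))"
  by (induction I rule: infinite_finite_induct) (simp_all add: mat_poly_add)

lemma mat_poly_linear_factor: "mat_poly B ([:- l, 1:] * p) = B ** mat_poly B p - mat l ** mat_poly B p"
proof -
  have "mat (- l) ** mat_poly B p = - (mat l ** mat_poly B p)"
    by (simp add: vec_eq_iff mat_mult_component)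
  moreover have "[:- l, 1:] * p = pCons 0 p + smult (- l) p"
    by simp
  ultimately show ?thesis
    by (simp only: mat_poly_add mat_poly_smult mat_poly_pCons mat_0) simp
qed

text \<open>The first \<open>N + 1\<close> powers of \<open>B\<close> live in a real vector space of dimension \<open>N\<close>. A linear relation
  between them attaches its coefficients to the matrices and not to the exponents, so the case of
  two equal powers is separate.\<close>

lemma annihilating_polynomial_exists: "\<exists>p. p \<noteq> 0 \<and> mat_poly B p = 0" for B :: "complex ^ 'n ^ 'n"
proof -
  define N where "N = DIM(complex ^ 'n ^ 'n)"
  define pw where "pw i = mat_poly B (monom 1 i)" for i
  show ?thesis
  proof (cases "inj_on pw {..N}")
    case False
    then obtain i j where ij: "i \<noteq> j" "pw i = pw j" by (auto simp: inj_on_def)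
    have "mat_poly B (monom 1 i + smult (-1) (monom 1 j)) = 0"
      using ij(2) unfolding mat_poly_add mat_poly_smult pw_def
      by (simp add: vec_eq_iff mat_mult_component)
    moreover have "monom (1 :: complex) i + smult (-1) (monom 1 j) \<noteq> 0"
      using ij(1) by (auto simp: poly_eq_iff intro!: exI[of _ i])
    ultimately show ?thesis by blast
  next
    case True
    then have "dependent (pw ` {..N})"
      by (intro dependent_biggerset) (simp add: card_image N_def)
    then obtain u where u: "\<exists>v\<in>pw ` {..N}. u v \<noteq> 0" "(\<Sum>v\<in>pw ` {..N}. u v *\<^sub>R v) = 0"
      by (auto simp: real_vector.dependent_finite)
    define p :: "complex poly" where "p = (\<Sum>i\<in>{..N}. smult (of_real (u (pw i))) (monom 1 i))"
    have smult: "mat (of_real r) ** M = r *\<^sub>R M" for r and M :: "complex ^ 'n ^ 'n"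
      unfolding vec_eq_iff mat_mult_component by (simp add: scaleR_conv_of_real[where 'a = complex])
    have "mat_poly B p = (\<Sum>i\<in>{..N}. u (pw i) *\<^sub>R pw i)"
      unfolding p_def mat_poly_sum mat_poly_smult smult pw_def ..
    also have "\<dots> = 0"
      using u(2) True by (simp add: sum.reindex)
    finally have "mat_poly B p = 0" .
    moreover obtain i where i: "i \<le> N" "u (pw i) \<noteq> 0" using u(1) by auto
    then have "coeff p i \<noteq> 0"
      by (simp add: p_def coeff_sum if_distrib cong: if_cong)
    then have "p \<noteq> 0" by auto
    ultimately show ?thesis by blast
  qed
qed

text \<open>In an annihilating polynomial of minimal degree every root is an eigenvalue: if the factor
  belonging to the root \<open>l\<close> is removed, the value \<open>R\<close> of the remaining polynomial is a nonzero matrix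
  with \<open>B R = l R\<close>, so any nonzero column of \<open>R\<close> is an eigenvector.\<close>

lemma annihilating_polynomial_roots_in_spectrum:
  fixes A :: "real ^ 'n ^ 'n"
  obtains ls where "mat_poly (complex_mat A) (\<Prod>l\<leftarrow>ls. [:- l, 1:]) = 0" "set ls \<subseteq> Spec A"
proof -
  define B where "B = complex_mat A"
  obtain p where p: "p \<noteq> 0" "mat_poly B p = 0"
    and min: "\<And>q. q \<noteq> 0 \<and> mat_poly B q = 0 \<Longrightarrow> degree p \<le> degree q"
    using ex_has_least_nat[of "\<lambda>p. p \<noteq> 0 \<and> mat_poly B p = 0" _ degree]
      annihilating_polynomial_exists[of B] by auto
  obtain M where M: "p = smult (lead_coeff p) (\<Prod>x\<in>#M. [:-x, 1:])"
    using alg_closed_imp_factorization[OF p(1)] by blast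
  obtain ls where ls: "mset ls = M" using ex_mset by blast
  define q where "q = (\<Prod>l\<leftarrow>ls. [:- l, 1:])"
  have pq: "p = smult (lead_coeff p) q"
    using M ls unfolding q_def by (metis mset_map prod_mset_prod_list)
  have roots: "l \<in> Spec A" if "l \<in> set ls" for l
  proof -
    have "[:- l, 1:] dvd q"
      unfolding q_def using that by (intro prod_list_dvd) auto
    then have "[:- l, 1:] dvd p"
      by (subst pq) (rule dvd_smult)
    then obtain r where r: "p = [:- l, 1:] * r" by (rule dvdE)
    with p(1) have r0: "r \<noteq> 0" by auto
    have "degree p = Suc (degree r)"
      using r r0 by (simp add: degree_mult_eq del: mult_pCons_left)
    with min[of r] r0 have "mat_poly B r \<noteq> 0" by auto
    then obtain i j where ij: "mat_poly B r $ i $ j \<noteq> 0" by (auto simp: vec_eq_iff)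
    define v where "v = (\<chi> i. mat_poly B r $ i $ j)"
    have "v \<noteq> 0" using ij by (auto simp: v_def vec_eq_iff)
    moreover have "B ** mat_poly B r = mat l ** mat_poly B r"
      using p(2) unfolding r mat_poly_linear_factor by simp
    then have "(B ** mat_poly B r) $ i $ j = l * mat_poly B r $ i $ j" for i
      by (simp add: mat_mult_component)
    then have "B *v v = l *s v"
      by (simp add: vec_eq_iff v_def matrix_vector_mult_def matrix_matrix_mult_def)
    ultimately show ?thesis by (auto simp: Spec_def B_def)
  qed
  have "mat (lead_coeff p) ** mat_poly B q = 0"
    using p(2) pq mat_poly_smult[of B "lead_coeff p" q] by simp
  then have "mat_poly B q = 0"
    using p(1) by (simp add: vec_eq_iff mat_mult_component)
  with that[of ls] roots show ?thesis by (auto simp: q_def B_def)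
qed

section \<open>Bounded solutions of hyperbolic linear systems\<close>

definition vanishing_at_top :: "(real \<Rightarrow>\<^sub>C 'a::real_normed_vector) \<Rightarrow> bool" where
  "vanishing_at_top h \<longleftrightarrow> (apply_bcontfun h \<longlongrightarrow> 0) at_top"

definition comp_op :: "('a::real_normed_vector \<Rightarrow> 'b::real_normed_vector) \<Rightarrow> (real \<Rightarrow>\<^sub>C 'a) \<Rightarrow> (real \<Rightarrow>\<^sub>C 'b)" where
  "comp_op L h = Bcontfun (\<lambda>t. L (apply_bcontfun h t))"

lemma comp_op_apply:
  assumes "bounded_linear L"
  shows "apply_bcontfun (comp_op L h) t = L (apply_bcontfun h t)"
proof -
  have "(\<lambda>t. L (apply_bcontfun h t)) \<in> bcontfun"
  proof (rule bcontfun_normI)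
    show "continuous_on UNIV (\<lambda>t. L (apply_bcontfun h t))"
      by (intro bounded_linear.continuous_on[OF assms]) simp
    show "norm (L (apply_bcontfun h t)) \<le> onorm L * norm h" for t
      using onorm[OF assms, of "h t"] mult_left_mono[OF norm_bounded[of h t] onorm_pos_le[OF assms]]
      by linarith
  qed
  then show ?thesis by (simp add: comp_op_def Bcontfun_inverse)
qed

lemma comp_op_eq:
  "bounded_linear L \<Longrightarrow> apply_bcontfun (comp_op L h) = (\<lambda>t. L (apply_bcontfun h t))"
  by (simp add: fun_eq_iff comp_op_apply)

lemma bounded_linear_comp_op:
  assumes "bounded_linear L"
  shows "bounded_linear (comp_op L)"
proof (rule bounded_linear_intro[where K = "onorm L"])
  show "norm (comp_op L h) \<le> norm h * onorm L" for h
  proof (rule norm_bound)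
    fix t
    have "norm (L (h t)) \<le> onorm L * norm (h t)" by (rule onorm[OF assms])
    also have "\<dots> \<le> onorm L * norm h"
      by (intro mult_left_mono norm_bounded onorm_pos_le[OF assms])
    finally show "norm (comp_op L h t) \<le> norm h * onorm L"
      by (simp add: comp_op_apply[OF assms] mult.commute)
  qed
qed (auto intro!: bcontfun_eqI simp: comp_op_apply[OF assms] linear_simps[OF assms])

lemma vanishing_comp_op:
  "bounded_linear L \<Longrightarrow> vanishing_at_top h \<Longrightarrow> vanishing_at_top (comp_op L h)"
  by (simp add: vanishing_at_top_def comp_op_eq bounded_linear.tendsto_zero)

definition scalar_op :: "complex \<Rightarrow> (real \<Rightarrow>\<^sub>C (complex ^ 'n)) \<Rightarrow> (real \<Rightarrow>\<^sub>C (complex ^ 'n))" where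
  "scalar_op l h = Bcontfun (bounded_solution l (apply_bcontfun h))"

context
  fixes l :: complex
  assumes l: "Re l \<noteq> 0"
begin

lemma scalar_op_apply: "apply_bcontfun (scalar_op l h) = bounded_solution l (apply_bcontfun h)"
proof -
  have "bounded_solution l (apply_bcontfun h) \<in> bcontfun"
  proof (rule bcontfun_normI)
    show "continuous_on UNIV (bounded_solution l (apply_bcontfun h))"
      using has_vector_derivative_continuous[OF
          bounded_solution_has_vector_derivative[OF l continuous_on_apply_bcontfun norm_bounded, of h]]
      by (simp add: continuous_on_eq_continuous_at)
  qed (rule norm_bounded_solution_le[OF l _ norm_bounded], simp)
  then show ?thesis by (simp add: scalar_op_def Bcontfun_inverse)
qed

lemma scalar_op_has_vector_derivative:
  "(apply_bcontfun (scalar_op l h) has_vector_derivative l *s scalar_op l h t + h t) (at t)"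
  unfolding scalar_op_apply
  by (rule bounded_solution_has_vector_derivative[OF l _ norm_bounded]) simp

lemma vanishing_scalar_op: "vanishing_at_top h \<Longrightarrow> vanishing_at_top (scalar_op l h)"
  unfolding vanishing_at_top_def scalar_op_apply
  by (rule bounded_solution_tendsto_0[OF l _ norm_bounded]) simp

lemma bounded_linear_scalar_op: "bounded_linear (scalar_op l)"
proof (rule bounded_linear_intro[where K = "green_norm l"])
  have int: "integrable lborel (\<lambda>s. green l s *s apply_bcontfun h (t - s))" for t h
    by (rule green_smult_integrable[OF l _ norm_bounded]) simp
  show "scalar_op l (h + h') = scalar_op l h + scalar_op l h'" for h h'
    by (rule bcontfun_eqI)
       (simp add: scalar_op_apply bounded_solution_def vector_add_ldistrib int)
  show "scalar_op l (r *\<^sub>R h) = r *\<^sub>R scalar_op l h" for r h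
  proof (rule bcontfun_eqI)
    have eq: "c *s (r *\<^sub>R v) = r *\<^sub>R (c *s v)" for c and v :: "complex ^ 'n"
      by (simp add: vec_eq_iff)
    show "scalar_op l (r *\<^sub>R h) t = (r *\<^sub>R scalar_op l h) t" for t
      by (simp add: scalar_op_apply bounded_solution_def eq)
  qed
  show "norm (scalar_op l h) \<le> norm h * green_norm l" for h
    by (rule norm_bound)
       (simp only: scalar_op_apply mult.commute[of "norm h"],
        rule norm_bounded_solution_le[OF l _ norm_bounded], simp)
qed

end

lemma bounded_linear_matrix: "bounded_linear ((*v) M)" for M :: "complex ^ 'n ^ 'm"
  by (rule linear_conv_bounded_linear[THEN iffD1])
     (auto intro!: linearI simp: matrix_vector_right_distrib matrix_vector_mult_scaleR)

text \<open>A system \<open>z' = B z + h\<close> is solved by scalar equations alone, without a normal form of \<open>B\<close>. Suppose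
  that \<open>z' = B z + h - q(B) w\<close>, and let \<open>w'\<close> be the bounded solution of \<open>(d/dt - l) w' = w\<close>, componentwise.
  Then \<open>z + q(B) w'\<close> solves the same equation with \<open>q(B) w\<close> replaced by \<open>(B - l) q(B) w'\<close>, because
  the constant matrix \<open>q(B)\<close> commutes with \<open>d/dt\<close>. So each step multiplies \<open>q\<close> by one more linear
  factor, starting with \<open>z = 0\<close>, \<open>q = 1\<close> and \<open>w = h\<close>.\<close>

lemma bounded_solution_operator_modulo_polynomial:
  fixes B :: "complex ^ 'n ^ 'n"
  assumes "\<And>l. l \<in> set ls \<Longrightarrow> Re l \<noteq> 0"
  shows "\<exists>K W :: (real \<Rightarrow>\<^sub>C (complex ^ 'n)) \<Rightarrow> (real \<Rightarrow>\<^sub>C (complex ^ 'n)).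
    bounded_linear K \<and> bounded_linear W \<and>
    (\<forall>h. vanishing_at_top h \<longrightarrow> vanishing_at_top (K h) \<and> vanishing_at_top (W h)) \<and>
    (\<forall>h t. (apply_bcontfun (K h) has_vector_derivative
        B *v K h t + h t - mat_poly B (\<Prod>l\<leftarrow>ls. [:- l, 1:]) *v W h t) (at t))"
  using assms
proof (induction ls)
  case Nil
  have "mat_poly B 1 = mat 1"
    unfolding one_pCons mat_poly_pCons mat_poly_0 by (simp add: vec_eq_iff matrix_matrix_mult_def)
  then show ?case
    by (intro exI[of _ "\<lambda>_. 0"] exI[of _ "\<lambda>h. h"])
       (auto simp: bounded_linear_ident vanishing_at_top_def zero_bcontfun.rep_eq[abs_def])
next
  case (Cons l ls)
  define q where "q = (\<Prod>l\<leftarrow>ls. [:- l, 1:])"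
  obtain K W :: "(real \<Rightarrow>\<^sub>C (complex ^ 'n)) \<Rightarrow> (real \<Rightarrow>\<^sub>C (complex ^ 'n))" where
      K: "bounded_linear K" and W: "bounded_linear W"
    and van: "\<And>h. vanishing_at_top h \<Longrightarrow> vanishing_at_top (K h) \<and> vanishing_at_top (W h)"
    and der: "\<And>h t. (apply_bcontfun (K h) has_vector_derivative
        B *v K h t + h t - mat_poly B q *v W h t) (at t)"
    using Cons unfolding q_def by auto
  have l: "Re l \<noteq> 0" using Cons.prems by simp
  let ?Q = "(*v) (mat_poly B q)"
  define W' where "W' h = scalar_op l (W h)" for h
  define K' where "K' h = K h + comp_op ?Q (W' h)" for h
  have W': "bounded_linear W'"
    unfolding W'_def by (rule bounded_linear_compose[OF bounded_linear_scalar_op[OF l] W])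
  then have K': "bounded_linear K'"
    unfolding K'_def
    by (intro bounded_linear_add K bounded_linear_compose[OF bounded_linear_comp_op]
        bounded_linear_matrix)
  have "vanishing_at_top (K' h) \<and> vanishing_at_top (W' h)" if "vanishing_at_top h" for h
  proof
    show *: "vanishing_at_top (W' h)"
      unfolding W'_def using van[OF that] by (intro vanishing_scalar_op[OF l]) simp
    show "vanishing_at_top (K' h)"
      using van[OF that] vanishing_comp_op[OF bounded_linear_matrix *, of "mat_poly B q"]
      unfolding vanishing_at_top_def K'_def
      by (auto simp: plus_bcontfun.rep_eq[abs_def] intro: tendsto_add_zero)
  qed
  moreover have "(apply_bcontfun (K' h) has_vector_derivative
      B *v K' h t + h t - mat_poly B (\<Prod>l\<leftarrow>l # ls. [:- l, 1:]) *v W' h t) (at t)" for h t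
  proof -
    have "apply_bcontfun (K' h) = (\<lambda>t. K h t + ?Q (W' h t))"
      by (simp add: K'_def comp_op_eq[OF bounded_linear_matrix] fun_eq_iff)
    moreover have "((\<lambda>t. K h t + ?Q (W' h t)) has_vector_derivative
        (B *v K h t + h t - ?Q (W h t)) + ?Q (l *s W' h t + W h t)) (at t)"
      unfolding W'_def
      by (intro has_vector_derivative_add der
          bounded_linear.has_vector_derivative[OF bounded_linear_matrix]
          scalar_op_has_vector_derivative[OF l])
    moreover have "(B *v K h t + h t - ?Q (W h t)) + ?Q (l *s W' h t + W h t) =
        B *v K' h t + h t - mat_poly B (\<Prod>l\<leftarrow>l # ls. [:- l, 1:]) *v W' h t"
    proof -
      have "(mat l ** mat_poly B q) *v w = ?Q (l *s w)" for w
        by (simp add: vec_eq_iff matrix_vector_mult_def mat_mult_component sum_distrib_left mult_ac)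
      then have "mat_poly B (\<Prod>l\<leftarrow>l # ls. [:- l, 1:]) *v w = B *v ?Q w - ?Q (l *s w)" for w
        by (simp add: mat_poly_linear_factor matrix_vector_mult_diff_rdistrib
            matrix_vector_mul_assoc del: mult_pCons_left flip: q_def)
      then show ?thesis
        by (simp add: K'_def comp_op_apply[OF bounded_linear_matrix] matrix_vector_right_distrib)
    qed
    ultimately show ?thesis by simp
  qed
  ultimately show ?case using K' W' by blast
qed

text \<open>If the linear factors multiply up to an annihilating polynomial of \<open>A\<close>, the error term
  \<open>q(A) w\<close> is gone. The roots can be taken in the spectrum, hence off the imaginary axis. As \<open>A\<close> is real,
  the real part of the complex solution is the solution for the real inhomogeneity.\<close>

theorem hyperbolic_bounded_solution_operator:
  fixes A :: "real ^ 'n ^ 'n"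
  assumes "Spec A \<inter> {z. Re z = 0} = {}"
  shows "\<exists>K :: (real \<Rightarrow>\<^sub>C (real ^ 'n)) \<Rightarrow> (real \<Rightarrow>\<^sub>C (real ^ 'n)). bounded_linear K \<and>
    (\<forall>h. vanishing_at_top h \<longrightarrow> vanishing_at_top (K h)) \<and>
    (\<forall>h t. (apply_bcontfun (K h) has_vector_derivative A *v K h t + h t) (at t))"
proof -
  obtain ls where ls: "mat_poly (complex_mat A) (\<Prod>l\<leftarrow>ls. [:- l, 1:]) = 0" "set ls \<subseteq> Spec A"
    by (rule annihilating_polynomial_roots_in_spectrum)
  then have "Re l \<noteq> 0" if "l \<in> set ls" for l using assms that by auto
  from bounded_solution_operator_modulo_polynomial[where ls = ls and B = "complex_mat A", OF this] ls(1)
  obtain K where K: "bounded_linear K" "\<And>h. vanishing_at_top h \<Longrightarrow> vanishing_at_top (K h)"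
    and der: "\<And>h t. (apply_bcontfun (K h) has_vector_derivative complex_mat A *v K h t + h t) (at t)"
    by auto
  define C :: "real ^ 'n \<Rightarrow> complex ^ 'n" where "C v = (\<chi> i. of_real (v $ i))" for v
  define R :: "complex ^ 'n \<Rightarrow> real ^ 'n" where "R v = (\<chi> i. Re (v $ i))" for v
  have C: "bounded_linear C" and R: "bounded_linear R"
    by (auto intro!: linear_conv_bounded_linear[THEN iffD1] linearI
        simp: C_def R_def vec_eq_iff scaleR_conv_of_real[where 'a = complex])
  have RC: "R (complex_mat A *v w + C v) = A *v R w + v" for w v
    by (simp add: R_def C_def vec_eq_iff matrix_vector_mult_def complex_mat_def)
  define K' where "K' h = comp_op R (K (comp_op C h))" for h
  have "bounded_linear K'"
    unfolding K'_def
    by (intro bounded_linear_compose[OF bounded_linear_comp_op[OF R]]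
        bounded_linear_compose[OF K(1)] bounded_linear_comp_op C)
  moreover have "vanishing_at_top (K' h)" if "vanishing_at_top h" for h
    unfolding K'_def using that by (intro vanishing_comp_op R K C)
  moreover have "(apply_bcontfun (K' h) has_vector_derivative A *v K' h t + h t) (at t)" for h t
    using bounded_linear.has_vector_derivative[OF R der[of "comp_op C h" t]]
    by (simp add: K'_def comp_op_eq[OF R] comp_op_apply[OF C] RC)
  ultimately show ?thesis by blast
qed


section \<open>Solutions that tend to a hyperbolic equilibrium\<close>

text \<open>This is the Lyapunov--Perron method: a solution is a fixed point of \<open>z \<mapsto> K (g(\<cdot>, z))\<close>, where \<open>K\<close>
  is the bounded operator that solves the linear system. For \<open>g\<close> with small Lipschitz constant this map is a
  contraction. It respects the closed subspace of the functions that vanish at infinity, so the fixed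
  point tends to \<open>0\<close>.\<close>

theorem hyperbolic_asymptotic_equilibrium:
  fixes A :: "real ^ 'n ^ 'n" and g :: "real \<Rightarrow> real ^ 'n \<Rightarrow> real ^ 'n"
  assumes hyp: "Spec A \<inter> {z. Re z = 0} = {}"
    and \<rho>: "\<rho> > 0" and cont: "continuous_on ({T..} \<times> cball 0 \<rho>) (\<lambda>(t, z). g t z)"
    and lip: "\<And>e. e > 0 \<Longrightarrow> \<exists>T r. r > 0 \<and>
      (\<forall>t\<ge>T. \<forall>z\<in>cball 0 r. \<forall>z'\<in>cball 0 r. norm (g t z - g t z') \<le> e * norm (z - z'))"
    and g0: "((\<lambda>t. g t 0) \<longlongrightarrow> 0) at_top"
  obtains z T' where "(z \<longlongrightarrow> 0) at_top"
    and "\<And>t. t > T' \<Longrightarrow> (z has_vector_derivative A *v z t + g t (z t)) (at t)"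
proof -
  obtain K :: "(real \<Rightarrow>\<^sub>C (real ^ 'n)) \<Rightarrow> (real \<Rightarrow>\<^sub>C (real ^ 'n))" where
      K: "bounded_linear K" and van: "\<And>h. vanishing_at_top h \<Longrightarrow> vanishing_at_top (K h)"
    and der: "\<And>h t. (apply_bcontfun (K h) has_vector_derivative A *v K h t + h t) (at t)"
    using hyperbolic_bounded_solution_operator[OF hyp] by blast
  obtain C where C: "C > 0" "\<And>h. norm (K h) \<le> norm h * C"
    using bounded_linear.pos_bounded[OF K] by blast
  \<comment> \<open>The Lipschitz constant that makes \<open>1 / 2\<close> the contraction constant.\<close>
  define e where "e = inverse (2 * C)"
  have e: "e > 0" using C by (simp add: e_def)
  obtain T1 r1 where r1: "r1 > 0"
    and lip1: "\<And>t z z'. \<lbrakk>t \<ge> T1; z \<in> cball 0 r1; z' \<in> cball 0 r1\<rbrakk> \<Longrightarrow> norm (g t z - g t z') \<le> e * norm (z - z')"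
    using lip[OF e] by blast
  obtain T2 where T2: "\<And>t. t \<ge> T2 \<Longrightarrow> norm (g t 0) < 1"
    using tendstoD[OF g0 zero_less_one] by (auto simp: eventually_at_top_linorder)
  define T' where "T' = max T (max T1 T2)"
  define r where "r = min r1 \<rho>"
  have r: "r > 0" using r1 \<rho> by (simp add: r_def)
  \<comment> \<open>The Lipschitz bound holds only for late times and in a small ball, so \<open>g\<close> is frozen before the
    time \<open>T'\<close> and precomposed with the projection onto the ball. Since the fixed point tends to \<open>0\<close>, the
    modification is invisible for late times.\<close>
  define P where "P = closest_point (cball (0 :: real ^ 'n) r)"
  have ne: "convex (cball (0 :: real ^ 'n) r)" "closed (cball (0 :: real ^ 'n) r)" "cball (0 :: real ^ 'n) r \<noteq> {}"
    using r by auto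
  have P_in: "P z \<in> cball 0 r" for z
    unfolding P_def using closest_point_in_set[OF ne(2,3)] .
  have P_lip: "norm (P z - P z') \<le> norm (z - z')" for z z'
    using closest_point_lipschitz[OF ne, of z z'] by (simp add: P_def dist_norm)
  have P_id: "z \<in> cball 0 r \<Longrightarrow> P z = z" for z
    unfolding P_def by (rule closest_point_self)
  have P_cont: "continuous_on S P" for S
    unfolding P_def by (rule continuous_on_closest_point[OF ne])
  define G where "G t z = g (max T' t) (P z)" for t z
  have G_lip: "norm (G t z - G t z') \<le> e * norm (z - z')" for t z z'
  proof -
    have "norm (G t z - G t z') \<le> e * norm (P z - P z')"
      unfolding G_def using P_in[of z] P_in[of z'] by (intro lip1) (auto simp: T'_def r_def)
    also have "\<dots> \<le> e * norm (z - z')"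
      using P_lip e by (intro mult_left_mono) auto
    finally show ?thesis .
  qed
  have P0: "P 0 = 0" using r by (intro P_id) simp
  have G_bound: "norm (G t z) \<le> e * r + norm (g (max T' t) 0)" for t z
  proof -
    have "norm (G t z) \<le> norm (g (max T' t) (P z) - g (max T' t) 0) + norm (g (max T' t) 0)"
      unfolding G_def by (metis diff_add_cancel norm_triangle_ineq)
    also have "norm (g (max T' t) (P z) - g (max T' t) 0) \<le> e * norm (P z - 0)"
      using P_in[of z] r1 by (intro lip1) (auto simp: T'_def r_def)
    also have "e * norm (P z - 0) \<le> e * r"
      using P_in[of z] e by (intro mult_left_mono) auto
    finally show ?thesis by simp
  qed
  define N where "N z = Bcontfun (\<lambda>t. G t (apply_bcontfun z t))" for z
  have N_apply: "apply_bcontfun (N z) = (\<lambda>t. G t (z t))" for z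
  proof -
    have "(\<lambda>t. G t (z t)) \<in> bcontfun"
    proof (rule bcontfun_normI)
      have "continuous_on UNIV (\<lambda>t. (\<lambda>(t, z). g t z) (max T' t, P (z t)))"
      proof (rule continuous_on_compose2[OF cont])
        show "continuous_on UNIV (\<lambda>t. (max T' t, P (z t)))"
          by (intro continuous_intros continuous_on_compose2[OF P_cont[of UNIV]]) auto
        show "range (\<lambda>t. (max T' t, P (z t))) \<subseteq> {T..} \<times> cball 0 \<rho>"
          using P_in by (auto simp: T'_def r_def le_max_iff_disj)
      qed
      then show "continuous_on UNIV (\<lambda>t. G t (z t))" by (simp add: G_def)
      show "norm (G t (z t)) \<le> e * r + 1" for t
      proof -
        have "norm (g (max T' t) 0) < 1" by (rule T2) (simp add: T'_def)
        then show ?thesis using G_bound[of t "z t"] by linarith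
      qed
    qed
    then show ?thesis by (simp add: N_def Bcontfun_inverse)
  qed
  define X where "X = {z :: real \<Rightarrow>\<^sub>C (real ^ 'n). vanishing_at_top z}"
  have "closed X"
    unfolding closed_sequential_limits
  proof (intro allI impI, elim conjE)
    fix x :: "nat \<Rightarrow> (real \<Rightarrow>\<^sub>C (real ^ 'n))" and y
    assume x: "\<forall>n. x n \<in> X" and lim: "x \<longlonglongrightarrow> y"
    have "(apply_bcontfun y \<longlongrightarrow> 0) at_top"
    proof (rule tendstoI)
      fix d :: real assume "d > 0"
      then obtain n where n: "dist (x n) y < d / 2"
        using tendstoD[OF lim, of "d / 2"] by (auto simp: eventually_sequentially)
      have "\<forall>\<^sub>F t in at_top. dist (x n t) 0 < d / 2"
        using x \<open>d > 0\<close> by (intro tendstoD) (auto simp: X_def vanishing_at_top_def)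
      then show "\<forall>\<^sub>F t in at_top. dist (y t) 0 < d"
      proof eventually_elim
        case (elim t)
        have "dist (y t) 0 \<le> dist (y t) (x n t) + dist (x n t) 0" by (rule dist_triangle)
        also have "dist (y t) (x n t) \<le> dist y (x n)" by (rule dist_bounded)
        finally show ?case using elim n by (simp add: dist_commute)
      qed
    qed
    then show "y \<in> X" by (simp add: X_def vanishing_at_top_def)
  qed
  then have "complete X" by (simp add: complete_eq_closed)
  moreover have "X \<noteq> {}"
    by (auto simp: X_def vanishing_at_top_def zero_bcontfun.rep_eq[abs_def] intro!: exI[of _ 0])
  moreover have "(\<lambda>z. K (N z)) ` X \<subseteq> X"
  proof -
    have "vanishing_at_top (N z)" if "vanishing_at_top z" for z
      unfolding vanishing_at_top_def N_apply
    proof (rule Lim_null_comparison)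
      have "norm (G t (z t)) \<le> e * norm (z t) + norm (g (max T' t) 0)" for t
      proof -
        have "norm (G t (z t)) \<le> norm (G t (z t) - G t 0) + norm (G t 0)"
          by (metis diff_add_cancel norm_triangle_ineq)
        then show ?thesis
          using G_lip[of t "z t" 0] P0 by (simp add: G_def)
      qed
      then show "\<forall>\<^sub>F t in at_top. norm (G t (z t)) \<le> e * norm (z t) + norm (g (max T' t) 0)"
        by simp
      have "((\<lambda>t. g (max T' t) 0) \<longlongrightarrow> 0) at_top"
        by (rule Lim_transform_eventually[OF g0])
           (auto simp: eventually_at_top_linorder max_def intro!: exI[of _ T'])
      then show "((\<lambda>t. e * norm (z t) + norm (g (max T' t) 0)) \<longlongrightarrow> 0) at_top"
        using that unfolding vanishing_at_top_def
        by (intro tendsto_add_zero tendsto_mult_right_zero tendsto_norm_zero)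
    qed
    then show ?thesis using van by (auto simp: X_def)
  qed
  moreover have "dist (K (N z)) (K (N z')) \<le> 1 / 2 * dist z z'" for z z'
  proof -
    have "dist (N z) (N z') \<le> e * dist z z'"
    proof (rule dist_bound)
      fix t
      have "dist (N z t) (N z' t) \<le> e * dist (z t) (z' t)"
        using G_lip by (simp add: N_apply dist_norm)
      also have "\<dots> \<le> e * dist z z'" using e by (intro mult_left_mono dist_bounded) auto
      finally show "dist (N z t) (N z' t) \<le> e * dist z z'" .
    qed
    moreover have "dist (K (N z)) (K (N z')) \<le> dist (N z) (N z') * C"
      using C(2)[of "N z - N z'"] by (simp add: dist_norm linear_simps[OF K])
    ultimately have "dist (K (N z)) (K (N z')) \<le> e * dist z z' * C"
      using C(1) by (meson mult_right_mono order_trans less_imp_le)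
    then show ?thesis using C(1) by (simp add: e_def field_simps)
  qed
  ultimately have "\<exists>!z. z \<in> X \<and> K (N z) = z"
    by (intro Banach_fix[where c = "1 / 2"]) auto
  then obtain z where z: "vanishing_at_top z" "K (N z) = z" by (auto simp: X_def)
  have lim: "(apply_bcontfun z \<longlongrightarrow> 0) at_top" using z(1) by (simp add: vanishing_at_top_def)
  obtain T3 where T3: "\<And>t. t \<ge> T3 \<Longrightarrow> norm (z t) < r"
    using tendstoD[OF lim r] by (auto simp: eventually_at_top_linorder)
  show ?thesis
  proof (rule that[OF lim])
    fix t assume t: "t > max T' T3"
    then have "P (z t) = z t" using T3[of t] by (intro P_id) auto
    then have "N z t = g t (z t)" using t by (simp add: N_apply G_def)
    then show "(z has_vector_derivative A *v z t + g t (z t)) (at t)"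
      using der[of "N z" t] z(2) by simp
  qed
qed

section \<open>Strict differentiability\<close>

text \<open>Unlike differentiability, strict differentiability at the single point \<open>a\<close> bounds the Lipschitz
  constant of \<open>f - L\<close> near \<open>a\<close>. Unlike continuous differentiability, it never refers to the derivative at
  other points, which keeps the chain rule short.\<close>

definition has_strict_derivative ::
  "('a::real_normed_vector \<Rightarrow> 'b::real_normed_vector) \<Rightarrow> ('a \<Rightarrow> 'b) \<Rightarrow> 'a \<Rightarrow> bool" where
  "has_strict_derivative f L a \<longleftrightarrow> bounded_linear L \<and>
     (\<forall>e>0. \<exists>d>0. \<forall>x\<in>ball a d. \<forall>y\<in>ball a d. norm (f x - f y - L (x - y)) \<le> e * norm (x - y))"

definition strictly_differentiable :: "('a::real_normed_vector \<Rightarrow> 'b::real_normed_vector) \<Rightarrow> 'a \<Rightarrow> bool" where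
  "strictly_differentiable f a \<longleftrightarrow> (\<exists>L. has_strict_derivative f L a)"

lemma has_strict_derivativeE:
  assumes "has_strict_derivative f L a" and "e > 0"
  obtains d where "d > 0"
    and "\<And>x y. x \<in> ball a d \<Longrightarrow> y \<in> ball a d \<Longrightarrow> norm (f x - f y - L (x - y)) \<le> e * norm (x - y)"
  using assms unfolding has_strict_derivative_def by blast

lemma has_strict_derivative_imp_has_derivative:
  assumes "has_strict_derivative f L a"
  shows "(f has_derivative L) (at a)"
  unfolding has_derivative_at_alt
proof (intro conjI allI impI)
  show "bounded_linear L" using assms by (simp add: has_strict_derivative_def)
  fix e :: real assume "e > 0"
  then obtain d where "d > 0"
    and d: "\<And>x y. x \<in> ball a d \<Longrightarrow> y \<in> ball a d \<Longrightarrow> norm (f x - f y - L (x - y)) \<le> e * norm (x - y)"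
    using has_strict_derivativeE[OF assms] by blast
  then show "\<exists>d>0. \<forall>y. norm (y - a) < d \<longrightarrow> norm (f y - f a - L (y - a)) \<le> e * norm (y - a)"
    by (intro exI[of _ d]) (auto simp: dist_norm norm_minus_commute)
qed

lemma strictly_differentiable_imp_isCont: "strictly_differentiable f a \<Longrightarrow> isCont f a"
  unfolding strictly_differentiable_def
  using has_derivative_continuous has_strict_derivative_imp_has_derivative by blast

lemma strictly_differentiable_lipschitz:
  assumes "strictly_differentiable f a"
  obtains d B where "d > 0" "B > 0"
    and "\<And>x y. x \<in> ball a d \<Longrightarrow> y \<in> ball a d \<Longrightarrow> norm (f x - f y) \<le> B * norm (x - y)"
proof -
  obtain L where L: "has_strict_derivative f L a"
    using assms by (auto simp: strictly_differentiable_def)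
  obtain d where d: "d > 0"
    "\<And>x y. x \<in> ball a d \<Longrightarrow> y \<in> ball a d \<Longrightarrow> norm (f x - f y - L (x - y)) \<le> 1 * norm (x - y)"
    using has_strict_derivativeE[OF L zero_less_one] by blast
  have "bounded_linear L" using L by (simp add: has_strict_derivative_def)
  then obtain K where K: "K > 0" "\<And>x. norm (L x) \<le> norm x * K"
    using bounded_linear.pos_bounded by blast
  show ?thesis
  proof (rule that[OF d(1), of "1 + K"])
    fix x y assume xy: "x \<in> ball a d" "y \<in> ball a d"
    have "norm (f x - f y) \<le> norm (f x - f y - L (x - y)) + norm (L (x - y))"
      by (metis diff_add_cancel norm_triangle_ineq)
    also have "\<dots> \<le> norm (x - y) + norm (x - y) * K"
      using d(2)[OF xy] K(2) by (intro add_mono) auto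
    finally show "norm (f x - f y) \<le> (1 + K) * norm (x - y)" by (simp add: algebra_simps)
  qed (use K in auto)
qed

lemma strictly_differentiable_compose:
  assumes f: "strictly_differentiable f a" and g: "strictly_differentiable g (f a)"
  shows "strictly_differentiable (\<lambda>x. g (f x)) a"
proof -
  obtain L where L: "has_strict_derivative f L a"
    using f by (auto simp: strictly_differentiable_def)
  obtain M where M: "has_strict_derivative g M (f a)"
    using g by (auto simp: strictly_differentiable_def)
  have lin: "bounded_linear L" "bounded_linear M"
    using L M by (auto simp: has_strict_derivative_def)
  obtain d B where d: "d > 0" "B > 0"
    and lip: "\<And>x y. x \<in> ball a d \<Longrightarrow> y \<in> ball a d \<Longrightarrow> norm (f x - f y) \<le> B * norm (x - y)"
    using strictly_differentiable_lipschitz[OF f] by blast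
  obtain C where C: "C > 0" "\<And>x. norm (M x) \<le> norm x * C"
    using bounded_linear.pos_bounded[OF lin(2)] by blast
  have "has_strict_derivative (\<lambda>x. g (f x)) (\<lambda>v. M (L v)) a"
    unfolding has_strict_derivative_def
  proof (intro conjI allI impI)
    show "bounded_linear (\<lambda>v. M (L v))" by (rule bounded_linear_compose[OF lin(2,1)])
    fix e :: real assume e: "e > 0"
    obtain d1 where d1: "d1 > 0"
      "\<And>x y. x \<in> ball (f a) d1 \<Longrightarrow> y \<in> ball (f a) d1 \<Longrightarrow>
         norm (g x - g y - M (x - y)) \<le> (e / (2 * B)) * norm (x - y)"
      using has_strict_derivativeE[OF M, of "e / (2 * B)"] e d by auto
    obtain d2 where d2: "d2 > 0"
      "\<And>x y. x \<in> ball a d2 \<Longrightarrow> y \<in> ball a d2 \<Longrightarrow>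
         norm (f x - f y - L (x - y)) \<le> (e / (2 * C)) * norm (x - y)"
      using has_strict_derivativeE[OF L, of "e / (2 * C)"] e C by auto
    define d' where "d' = min d (min d2 (d1 / B))"
    have "norm (g (f x) - g (f y) - M (L (x - y))) \<le> e * norm (x - y)"
      if xy: "x \<in> ball a d'" "y \<in> ball a d'" for x y
    proof -
      have near: "f z \<in> ball (f a) d1" if "z \<in> ball a d'" for z
      proof -
        have "norm (f a - f z) \<le> B * norm (a - z)"
          using that d by (intro lip) (auto simp: d'_def)
        also have "\<dots> < B * (d1 / B)"
          using that d by (intro mult_strict_left_mono) (auto simp: d'_def dist_norm)
        finally show ?thesis using d by (simp add: dist_norm)
      qed
      have "norm (g (f x) - g (f y) - M (f x - f y)) \<le> (e / (2 * B)) * norm (f x - f y)"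
        by (intro d1(2) near xy)
      also have "\<dots> \<le> (e / (2 * B)) * (B * norm (x - y))"
        using xy d e by (intro mult_left_mono lip) (auto simp: d'_def)
      finally have 1: "norm (g (f x) - g (f y) - M (f x - f y)) \<le> e / 2 * norm (x - y)"
        using d by simp
      have "norm (M (f x - f y - L (x - y))) \<le> norm (f x - f y - L (x - y)) * C"
        by (rule C(2))
      also have "\<dots> \<le> ((e / (2 * C)) * norm (x - y)) * C"
        using xy C by (intro mult_right_mono d2(2)) (auto simp: d'_def)
      finally have 2: "norm (M (f x - f y - L (x - y))) \<le> e / 2 * norm (x - y)"
        using C by simp
      have "g (f x) - g (f y) - M (L (x - y)) =
          (g (f x) - g (f y) - M (f x - f y)) + M (f x - f y - L (x - y))"
        by (simp add: linear_simps[OF lin(2)])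
      then have "norm (g (f x) - g (f y) - M (L (x - y))) \<le>
          norm (g (f x) - g (f y) - M (f x - f y)) + norm (M (f x - f y - L (x - y)))"
        by (metis norm_triangle_ineq)
      with 1 2 show ?thesis by (simp add: algebra_simps)
    qed
    moreover have "d' > 0" using d d1 d2 by (simp add: d'_def)
    ultimately show "\<exists>d>0. \<forall>x\<in>ball a d. \<forall>y\<in>ball a d.
        norm (g (f x) - g (f y) - M (L (x - y))) \<le> e * norm (x - y)" by blast
  qed
  then show ?thesis by (auto simp: strictly_differentiable_def)
qed

lemma strictly_differentiable_bounded_linear: "bounded_linear f \<Longrightarrow> strictly_differentiable f a"
  unfolding strictly_differentiable_def has_strict_derivative_def
  by (intro exI[of _ f]) (auto simp: linear_simps intro!: exI[of _ 1])

lemma strictly_differentiable_const: "strictly_differentiable (\<lambda>_. c) a"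
  unfolding strictly_differentiable_def has_strict_derivative_def
  by (intro exI[of _ "\<lambda>_. 0"]) (auto intro!: exI[of _ 1])

lemma strictly_differentiable_vec:
  fixes f :: "'a::real_normed_vector \<Rightarrow> real ^ 'n"
  assumes "\<And>i. strictly_differentiable (\<lambda>x. f x $ i) a"
  shows "strictly_differentiable f a"
proof -
  obtain L where L: "\<And>i. has_strict_derivative (\<lambda>x. f x $ i) (L i) a"
    using assms unfolding strictly_differentiable_def by metis
  have lin: "bounded_linear (L i)" for i using L by (simp add: has_strict_derivative_def)
  have "has_strict_derivative f (\<lambda>v. \<chi> i. L i v) a"
    unfolding has_strict_derivative_def
  proof (intro conjI allI impI)
    show "bounded_linear (\<lambda>v. \<chi> i. L i v)"
    proof -
      have "(\<chi> i. L i v) = (\<Sum>i\<in>UNIV. L i v *\<^sub>R axis i 1)" for v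
        by (simp add: vec_eq_iff axis_def if_distrib cong: if_cong)
      then show ?thesis
        by (simp add: bounded_linear_sum bounded_linear_scaleR_const lin)
    qed
    fix e :: real assume e: "e > 0"
    define e' where "e' = e / real CARD('n)"
    have e': "e' > 0" using e by (simp add: e'_def)
    have "\<exists>d>0. \<forall>x\<in>ball a d. \<forall>y\<in>ball a d. norm (f x $ i - f y $ i - L i (x - y)) \<le> e' * norm (x - y)" for i
      using L e' by (simp add: has_strict_derivative_def)
    then obtain d where d: "\<And>i. d i > 0"
      "\<And>i x y. x \<in> ball a (d i) \<Longrightarrow> y \<in> ball a (d i) \<Longrightarrow>
         norm (f x $ i - f y $ i - L i (x - y)) \<le> e' * norm (x - y)"
      by metis
    define d' where "d' = Min (range d)"
    have "d' > 0" using d(1) by (simp add: d'_def)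
    moreover have "norm (f x - f y - (\<chi> i. L i (x - y))) \<le> e * norm (x - y)"
      if xy: "x \<in> ball a d'" "y \<in> ball a d'" for x y
    proof -
      have le: "d' \<le> d i" for i by (simp add: d'_def)
      have "norm (f x - f y - (\<chi> i. L i (x - y))) \<le>
          (\<Sum>i\<in>UNIV. \<bar>(f x - f y - (\<chi> i. L i (x - y))) $ i\<bar>)"
        by (rule norm_le_l1_cart)
      also have "\<dots> \<le> (\<Sum>i\<in>(UNIV :: 'n set). e' * norm (x - y))"
      proof (rule sum_mono)
        fix i
        have "x \<in> ball a (d i)" "y \<in> ball a (d i)" using xy le[of i] by auto
        then show "\<bar>(f x - f y - (\<chi> i. L i (x - y))) $ i\<bar> \<le> e' * norm (x - y)"
          using d(2)[of x i y] by simp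
      qed
      also have "\<dots> = e * norm (x - y)" by (simp add: e'_def)
      finally show ?thesis .
    qed
    ultimately show "\<exists>d>0. \<forall>x\<in>ball a d. \<forall>y\<in>ball a d.
        norm (f x - f y - (\<chi> i. L i (x - y))) \<le> e * norm (x - y)" by blast
  qed
  then show ?thesis by (auto simp: strictly_differentiable_def)
qed

text \<open>The mean value inequality for \<open>f - f' a\<close>.\<close>

lemma continuously_differentiable_imp_strictly_differentiable:
  assumes S: "open S" "a \<in> S"
    and der: "\<And>x. x \<in> S \<Longrightarrow> (f has_derivative f' x) (at x)"
    and cont: "\<And>e. e > 0 \<Longrightarrow> \<forall>\<^sub>F x in nhds a. \<forall>v. norm (f' x v - f' a v) \<le> e * norm v"
  shows "strictly_differentiable f a"
proof -
  have lin: "bounded_linear (f' x)" if "x \<in> S" for x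
    using der[OF that] by (rule has_derivative_bounded_linear)
  have "has_strict_derivative f (f' a) a"
    unfolding has_strict_derivative_def
  proof (intro conjI allI impI lin S(2))
    fix e :: real assume e: "e > 0"
    have "\<forall>\<^sub>F x in nhds a. x \<in> S \<and> (\<forall>v. norm (f' x v - f' a v) \<le> e * norm v)"
      using cont[OF e] eventually_nhds_in_open[OF S] by eventually_elim auto
    then obtain d where d: "d > 0"
      and dS: "\<And>x. x \<in> ball a d \<Longrightarrow> x \<in> S"
      and dv: "\<And>x v. x \<in> ball a d \<Longrightarrow> norm (f' x v - f' a v) \<le> e * norm v"
      unfolding eventually_nhds_metric by (auto simp: dist_commute)
    have "norm (f x - f y - f' a (x - y)) \<le> e * norm (x - y)"
      if xy: "x \<in> ball a d" "y \<in> ball a d" for x y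
    proof -
      have "norm ((f x - f' a x) - (f y - f' a y)) \<le> e * norm (x - y)"
      proof (rule differentiable_bound[OF convex_ball _ _ xy])
        fix z assume z: "z \<in> ball a d"
        show "((\<lambda>x. f x - f' a x) has_derivative (\<lambda>v. f' z v - f' a v)) (at z within ball a d)"
          by (intro has_derivative_diff has_derivative_at_withinI[OF der[OF dS[OF z]]]
              bounded_linear_imp_has_derivative lin S(2))
        show "onorm (\<lambda>v. f' z v - f' a v) \<le> e"
          using dv[OF z] e by (intro onorm_bound) auto
      qed
      then show ?thesis by (simp add: linear_simps[OF lin[OF S(2)]] algebra_simps)
    qed
    with d show "\<exists>d>0. \<forall>x\<in>ball a d. \<forall>y\<in>ball a d. norm (f x - f y - f' a (x - y)) \<le> e * norm (x - y)"
      by blast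
  qed
  then show ?thesis by (auto simp: strictly_differentiable_def)
qed

lemma strictly_differentiable_real:
  fixes f :: "real \<Rightarrow> real"
  assumes "open S" "a \<in> S" and "\<And>x. x \<in> S \<Longrightarrow> (f has_real_derivative f' x) (at x)" and "isCont f' a"
  shows "strictly_differentiable f a"
proof (rule continuously_differentiable_imp_strictly_differentiable[OF assms(1,2)])
  show "(f has_derivative (*) (f' x)) (at x)" if "x \<in> S" for x
    using assms(3)[OF that] by (simp add: has_field_derivative_def)
  fix e :: real assume "e > 0"
  have "(f' \<longlongrightarrow> f' a) (nhds a)" using assms(4) by (simp add: isCont_def tendsto_nhds_iff)
  from tendstoD[OF this \<open>e > 0\<close>]
  show "\<forall>\<^sub>F x in nhds a. \<forall>v. norm (f' x * v - f' a * v) \<le> e * norm v"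
    by eventually_elim
       (auto simp: dist_norm abs_mult intro!: mult_right_mono simp flip: left_diff_distrib)
qed

lemma C_r_on_imp_continuous_on: "C_r_on r f S \<Longrightarrow> continuous_on S f"
  by (cases r) (auto intro!: continuous_at_imp_continuous_on differentiable_imp_continuous_within)

text \<open>In finite dimension, continuity of the derivative in each basis direction is continuity in the
  operator norm.\<close>

lemma C_r_on_imp_strictly_differentiable:
  fixes f :: "'a::euclidean_space \<Rightarrow> 'b::real_normed_vector"
  assumes "C_r_on r f S" "r \<ge> 1" "open S" "a \<in> S"
  shows "strictly_differentiable f a"
proof -
  obtain r' where r: "r = Suc r'" using assms(2) by (cases r) auto
  have diff: "f differentiable (at x)" if "x \<in> S" for x using assms(1) r that by auto
  have cont: "continuous_on S (\<lambda>x. frechet_derivative f (at x) v)" for v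
    using assms(1) r by (intro C_r_on_imp_continuous_on[of r']) auto
  have lin: "bounded_linear (frechet_derivative f (at x))" if "x \<in> S" for x
    using diff[OF that] by (simp add: frechet_derivative_works has_derivative_bounded_linear)
  show ?thesis
  proof (rule continuously_differentiable_imp_strictly_differentiable[OF assms(3,4)])
    show "(f has_derivative frechet_derivative f (at x)) (at x)" if "x \<in> S" for x
      using diff[OF that] by (simp add: frechet_derivative_works)
    fix e :: real assume e: "e > 0"
    define e' where "e' = e / real (DIM('a))"
    have e': "e' > 0" using e by (simp add: e'_def)
    have "\<forall>\<^sub>F x in nhds a. norm (frechet_derivative f (at x) b - frechet_derivative f (at a) b) < e'" for b
    proof -
      have "isCont (\<lambda>x. frechet_derivative f (at x) b) a"
        using cont assms(3,4) by (simp add: continuous_on_eq_continuous_at)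
      then have "((\<lambda>x. frechet_derivative f (at x) b) \<longlongrightarrow> frechet_derivative f (at a) b) (nhds a)"
        by (simp add: isCont_def tendsto_nhds_iff)
      from tendstoD[OF this e'] show ?thesis by (simp add: dist_norm)
    qed
    then have "\<forall>\<^sub>F x in nhds a. \<forall>b\<in>Basis. norm (frechet_derivative f (at x) b - frechet_derivative f (at a) b) < e'"
      by (simp add: eventually_ball_finite)
    with eventually_nhds_in_open[OF assms(3,4)]
    show "\<forall>\<^sub>F x in nhds a. \<forall>v. norm (frechet_derivative f (at x) v - frechet_derivative f (at a) v) \<le> e * norm v"
    proof eventually_elim
      case (elim x)
      show ?case
      proof
        fix v
        define D where "D v = frechet_derivative f (at x) v - frechet_derivative f (at a) v" for v
        have D: "linear D"
          unfolding D_def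
          using bounded_linear_sub[OF lin[OF elim(1)] lin[OF assms(4)]] by (simp add: bounded_linear.linear)
        have "norm (D v) = norm (D (\<Sum>b\<in>Basis. (v \<bullet> b) *\<^sub>R b))"
          by (simp add: euclidean_representation)
        also have "\<dots> = norm (\<Sum>b\<in>Basis. (v \<bullet> b) *\<^sub>R D b)"
          by (simp add: linear_sum[OF D] linear_scale[OF D])
        also have "\<dots> \<le> (\<Sum>b\<in>Basis. norm ((v \<bullet> b) *\<^sub>R D b))" by (rule norm_sum)
        also have "\<dots> \<le> (\<Sum>b\<in>(Basis::'a set). norm v * e')"
          using elim(2)
          by (intro sum_mono) (simp add: D_def Basis_le_norm mult_mono less_imp_le)
        also have "\<dots> = e * norm v" by (simp add: e'_def)
        finally show "norm (frechet_derivative f (at x) v - frechet_derivative f (at a) v) \<le> e * norm v"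
          by (simp add: D_def)
      qed
    qed
  qed
qed

lemma strictly_differentiable_Pair:
  assumes "strictly_differentiable f a" "strictly_differentiable g a"
  shows "strictly_differentiable (\<lambda>x. (f x, g x)) a"
proof -
  obtain L where L: "has_strict_derivative f L a"
    using assms(1) by (auto simp: strictly_differentiable_def)
  obtain M where M: "has_strict_derivative g M a"
    using assms(2) by (auto simp: strictly_differentiable_def)
  have "has_strict_derivative (\<lambda>x. (f x, g x)) (\<lambda>v. (L v, M v)) a"
    unfolding has_strict_derivative_def
  proof (intro conjI allI impI)
    show "bounded_linear (\<lambda>v. (L v, M v))"
      using L M by (intro bounded_linear_Pair) (auto simp: has_strict_derivative_def)
    fix e :: real assume e: "e > 0"
    obtain d1 where d1: "d1 > 0" "\<And>x y. x \<in> ball a d1 \<Longrightarrow> y \<in> ball a d1 \<Longrightarrow>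
         norm (f x - f y - L (x - y)) \<le> (e / 2) * norm (x - y)"
      using has_strict_derivativeE[OF L, of "e / 2"] e by auto
    obtain d2 where d2: "d2 > 0" "\<And>x y. x \<in> ball a d2 \<Longrightarrow> y \<in> ball a d2 \<Longrightarrow>
         norm (g x - g y - M (x - y)) \<le> (e / 2) * norm (x - y)"
      using has_strict_derivativeE[OF M, of "e / 2"] e by auto
    have "norm ((f x, g x) - (f y, g y) - (L (x - y), M (x - y))) \<le> e * norm (x - y)"
      if "x \<in> ball a (min d1 d2)" "y \<in> ball a (min d1 d2)" for x y
    proof -
      have "norm ((f x, g x) - (f y, g y) - (L (x - y), M (x - y))) \<le>
          norm (f x - f y - L (x - y)) + norm (g x - g y - M (x - y))"
        by (simp add: norm_Pair_le)
      with d1(2)[of x y] d2(2)[of x y] that show ?thesis by simp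
    qed
    then show "\<exists>d>0. \<forall>x\<in>ball a d. \<forall>y\<in>ball a d.
        norm ((f x, g x) - (f y, g y) - (L (x - y), M (x - y))) \<le> e * norm (x - y)"
      using d1 d2 by (intro exI[of _ "min d1 d2"]) auto
  qed
  then show ?thesis by (auto simp: strictly_differentiable_def)
qed

lemma strictly_differentiable_mult:
  fixes f g :: "'a::real_normed_vector \<Rightarrow> real"
  assumes "strictly_differentiable f a" "strictly_differentiable g a"
  shows "strictly_differentiable (\<lambda>x. f x * g x) a"
proof -
  have "strictly_differentiable (\<lambda>z :: real \<times> real. fst z * snd z) z0" for z0
  proof (rule continuously_differentiable_imp_strictly_differentiable[where S = UNIV and
        f' = "\<lambda>z v. fst z * snd v + fst v * snd z"])
    show "((\<lambda>z. fst z * snd z) has_derivative (\<lambda>v. fst z * snd v + fst v * snd z)) (at z)" for z :: "real \<times> real"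
      by (auto intro!: derivative_eq_intros)
    fix e :: real assume e: "e > 0"
    show "\<forall>\<^sub>F z in nhds z0. \<forall>v. norm (fst z * snd v + fst v * snd z - (fst z0 * snd v + fst v * snd z0)) \<le> e * norm v"
      unfolding eventually_nhds_metric
    proof (intro exI[of _ "e / 2"] conjI allI impI)
      fix z v :: "real \<times> real" assume z: "dist z z0 < e / 2"
      have "norm (fst z * snd v + fst v * snd z - (fst z0 * snd v + fst v * snd z0)) =
          norm (fst (z - z0) * snd v + fst v * snd (z - z0))"
        by (simp add: algebra_simps)
      also have "\<dots> \<le> norm (fst (z - z0)) * norm (snd v) + norm (fst v) * norm (snd (z - z0))"
        by (metis norm_triangle_ineq norm_mult)
      also have "\<dots> \<le> (e / 2) * norm v + norm v * (e / 2)"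
        using z e norm_fst_le[of "fst (z - z0)" "snd (z - z0)"] norm_snd_le[of "snd (z - z0)" "fst (z - z0)"]
          norm_fst_le[of "fst v" "snd v"] norm_snd_le[of "snd v" "fst v"]
        by (intro add_mono mult_mono) (auto simp: dist_norm simp del: fst_diff snd_diff)
      finally show "norm (fst z * snd v + fst v * snd z - (fst z0 * snd v + fst v * snd z0)) \<le> e * norm v"
        by simp
    qed (use e in simp)
  qed auto
  from strictly_differentiable_compose[OF strictly_differentiable_Pair[OF assms] this]
  show ?thesis by simp
qed

lemma strictly_differentiable_add:
  assumes "strictly_differentiable f a" "strictly_differentiable g a"
  shows "strictly_differentiable (\<lambda>x. f x + g x) a"
proof -
  have "strictly_differentiable (\<lambda>z. fst z + snd z) (f a, g a)"
    by (intro strictly_differentiable_bounded_linear bounded_linear_add bounded_linear_fst bounded_linear_snd)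
  from strictly_differentiable_compose[OF strictly_differentiable_Pair[OF assms] this]
  show ?thesis by simp
qed

lemma strictly_differentiable_sum:
  assumes "\<And>i. i \<in> I \<Longrightarrow> strictly_differentiable (f i) a"
  shows "strictly_differentiable (\<lambda>x. \<Sum>i\<in>I. f i x) a"
  using assms
  by (induction I rule: infinite_finite_induct)
     (auto intro: strictly_differentiable_const strictly_differentiable_add)

lemma strictly_differentiable_power:
  fixes f :: "'a::real_normed_vector \<Rightarrow> real"
  shows "strictly_differentiable f a \<Longrightarrow> strictly_differentiable (\<lambda>x. f x ^ n) a"
  by (induction n) (auto intro: strictly_differentiable_mult strictly_differentiable_const)

lemma strictly_differentiable_powr:
  fixes f :: "'a::real_normed_vector \<Rightarrow> real"
  assumes "strictly_differentiable f a" "f a > 0"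
  shows "strictly_differentiable (\<lambda>x. f x powr c) a"
proof (rule strictly_differentiable_compose[OF assms(1)])
  show "strictly_differentiable (\<lambda>x. x powr c) (f a)"
    using assms(2)
    by (intro strictly_differentiable_real[where S = "{0<..}" and f' = "\<lambda>x. c * x powr (c - 1)"])
       (auto intro!: continuous_intros DERIV_powr derivative_eq_intros)
qed

lemma strictly_differentiable_inverse:
  fixes f :: "'a::real_normed_vector \<Rightarrow> real"
  assumes "strictly_differentiable f a" "f a > 0"
  shows "strictly_differentiable (\<lambda>x. inverse (f x)) a"
proof (rule strictly_differentiable_compose[OF assms(1)])
  show "strictly_differentiable inverse (f a)"
  proof (rule strictly_differentiable_real[where S = "{0<..}" and f' = "\<lambda>x. - (inverse x ^ Suc (Suc 0))"])
    show "(inverse has_real_derivative - (inverse x ^ Suc (Suc 0))) (at x)" if "x \<in> {0<..}" for x :: real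
      using DERIV_inverse[of x] that by simp
  qed (use assms(2) in \<open>auto intro!: continuous_intros\<close>)
qed

lemmas strictly_differentiable_intros =
  strictly_differentiable_const strictly_differentiable_Pair strictly_differentiable_mult
  strictly_differentiable_add strictly_differentiable_sum strictly_differentiable_power strictly_differentiable_powr
  strictly_differentiable_inverse

text \<open>Continuity of \<open>\<phi>\<close> in the Lipschitz form is an assumption, since it is immediate when \<open>\<eta>\<close> expands
  distances; the linear estimate for \<open>\<eta>\<close> can then be read backwards.\<close>

lemma strictly_differentiable_local_inverse:
  fixes \<eta> :: "real \<Rightarrow> real"
  assumes "strictly_differentiable \<eta> b" and d: "d > 0"
    and inv: "\<And>s. \<bar>s - a\<bar> < d \<Longrightarrow> \<eta> (\<phi> s) = s"
    and lip: "\<And>s s'. \<bar>s - a\<bar> < d \<Longrightarrow> \<bar>s' - a\<bar> < d \<Longrightarrow> \<bar>\<phi> s - \<phi> s'\<bar> \<le> \<bar>s - s'\<bar>"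
    and b: "\<phi> a = b"
  shows "strictly_differentiable \<phi> a"
proof -
  obtain L where L: "has_strict_derivative \<eta> L b"
    using assms(1) by (auto simp: strictly_differentiable_def)
  then have linL: "bounded_linear L" by (simp add: has_strict_derivative_def)
  define D where "D = L 1"
  have LD: "L v = D * v" for v
    using linear_simps(5)[OF linL, of v 1] by (simp add: D_def mult.commute)
  \<comment> \<open>With \<open>D = 0\<close>, \<open>\<eta>\<close> would contract distances near \<open>b\<close>, but \<open>\<eta> \<circ> \<phi>\<close> is the identity and \<open>\<phi>\<close>
    does not expand distances.\<close>
  have D0: "D \<noteq> 0"
  proof
    assume "D = 0"
    obtain r where r: "r > 0"
      "\<And>x y. x \<in> ball b r \<Longrightarrow> y \<in> ball b r \<Longrightarrow> norm (\<eta> x - \<eta> y - L (x - y)) \<le> (1 / 2) * norm (x - y)"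
      using has_strict_derivativeE[OF L, of "1 / 2"] by auto
    define s where "s = a + min d r / 2"
    have s: "\<bar>s - a\<bar> < d" "\<bar>s - a\<bar> < r" "s \<noteq> a" using d r by (auto simp: s_def)
    have "\<bar>\<phi> s - b\<bar> \<le> \<bar>s - a\<bar>" using lip[of s a] s d b by simp
    then have "\<phi> s \<in> ball b r" "b \<in> ball b r" using s r by (auto simp: dist_real_def)
    then have "\<bar>\<eta> (\<phi> s) - \<eta> b\<bar> \<le> (1 / 2) * \<bar>\<phi> s - b\<bar>"
      using r(2)[of "\<phi> s" b] by (simp add: LD \<open>D = 0\<close>)
    moreover have "\<eta> (\<phi> s) = s" "\<eta> b = a" using inv[of s] inv[of a] s d b by auto
    ultimately have "\<bar>s - a\<bar> \<le> (1 / 2) * \<bar>\<phi> s - b\<bar>" by simp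
    moreover have "\<bar>s - a\<bar> > 0" using s(3) by simp
    ultimately have "0 < \<bar>\<phi> s - b\<bar>" "\<bar>\<phi> s - b\<bar> \<le> (1 / 2) * \<bar>\<phi> s - b\<bar>"
      using \<open>\<bar>\<phi> s - b\<bar> \<le> \<bar>s - a\<bar>\<close> by (auto simp del: abs_le_iff)
    then show False by simp
  qed
  have "has_strict_derivative \<phi> (\<lambda>v. v / D) a"
    unfolding has_strict_derivative_def
  proof (intro conjI allI impI)
    show "bounded_linear (\<lambda>v. v / D)" by (rule bounded_linear_divide)
    fix e :: real assume e: "e > 0"
    obtain r where r: "r > 0"
      "\<And>x y. x \<in> ball b r \<Longrightarrow> y \<in> ball b r \<Longrightarrow> norm (\<eta> x - \<eta> y - L (x - y)) \<le> (e * \<bar>D\<bar>) * norm (x - y)"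
      using has_strict_derivativeE[OF L, of "e * \<bar>D\<bar>"] e D0 by auto
    have "norm (\<phi> x - \<phi> y - (x - y) / D) \<le> e * norm (x - y)"
      if xy: "x \<in> ball a (min d r)" "y \<in> ball a (min d r)" for x y
    proof -
      have near: "\<phi> z \<in> ball b r" if "z \<in> ball a (min d r)" for z
        using lip[of a z] that d b abs_minus_commute[of z a] by (auto simp: dist_real_def)
      have "\<bar>x - y - D * (\<phi> x - \<phi> y)\<bar> \<le> (e * \<bar>D\<bar>) * \<bar>\<phi> x - \<phi> y\<bar>"
        using r(2)[OF near[OF xy(1)] near[OF xy(2)]] inv[of x] inv[of y] xy
        by (simp add: dist_real_def LD abs_minus_commute)
      also have "\<dots> \<le> (e * \<bar>D\<bar>) * \<bar>x - y\<bar>"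
        using lip[of x y] xy e by (intro mult_left_mono) (auto simp: dist_real_def abs_minus_commute)
      finally have "\<bar>x - y - D * (\<phi> x - \<phi> y)\<bar> \<le> \<bar>D\<bar> * (e * \<bar>x - y\<bar>)"
        by (simp add: mult_ac)
      moreover have "x - y - D * (\<phi> x - \<phi> y) = - (D * (\<phi> x - \<phi> y - (x - y) / D))"
        using D0 by (simp add: field_simps)
      ultimately have "\<bar>D\<bar> * \<bar>\<phi> x - \<phi> y - (x - y) / D\<bar> \<le> \<bar>D\<bar> * (e * \<bar>x - y\<bar>)"
        by (simp only: abs_minus_cancel abs_mult)
      then show ?thesis using D0 by simp
    qed
    then show "\<exists>d>0. \<forall>x\<in>ball a d. \<forall>y\<in>ball a d. norm (\<phi> x - \<phi> y - (x - y) / D) \<le> e * norm (x - y)"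
      using d r by (intro exI[of _ "min d r"]) auto
  qed
  then show ?thesis by (auto simp: strictly_differentiable_def)
qed

section \<open>The quasi-homogeneous scaling\<close>

lemma s_Lam_s_Lam: "s_Lam \<alpha> a (s_Lam \<alpha> b y) = s_Lam \<alpha> (a * b) y"
  by (simp add: s_Lam_def vec_eq_iff power_mult_distrib mult_ac)

lemma s_Lam_1 [simp]: "s_Lam \<alpha> 1 y = y"
  by (simp add: s_Lam_def vec_eq_iff)

lemma s_Lam_in_cylinder:
  assumes "cylinder_domain \<alpha> U" "y \<in> U"
  shows "s_Lam \<alpha> s y \<in> U"
proof -
  have "s_Lam \<alpha> s y $ j = y $ j" if "j \<notin> I_of \<alpha>" for j
    using that by (simp add: s_Lam_def I_of_def)
  with assms show ?thesis unfolding cylinder_domain_def by blast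
qed

lemma c_of_pos: "c_of \<alpha> > 0" for \<alpha> :: "'n::finite \<Rightarrow> nat"
proof -
  have "c_of \<alpha> \<noteq> 0"
    unfolding c_of_def by (subst Lcm_0_iff) (auto simp: I_of_def)
  then show ?thesis by simp
qed

lemma alpha_mult_beta: "i \<in> I_of \<alpha> \<Longrightarrow> \<alpha> i * beta \<alpha> i = c_of \<alpha>"
  by (simp add: beta_def c_of_def dvd_Lcm)

lemma beta_pos: "i \<in> I_of \<alpha> \<Longrightarrow> beta \<alpha> i > 0" for \<alpha> :: "'n::finite \<Rightarrow> nat"
  using alpha_mult_beta[of i \<alpha>] c_of_pos[of \<alpha>] by (cases "beta \<alpha> i") auto

lemma p_sum_nonneg: "0 \<le> (\<Sum>i\<in>I_of \<alpha>. (x $ i) ^ (2 * beta \<alpha> i))" for x :: "real ^ 'n"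
  by (intro sum_nonneg) (simp add: power_mult)

lemma p_fun_pos_iff: "0 < p_fun \<alpha> x \<longleftrightarrow> (\<exists>i\<in>I_of \<alpha>. x $ i \<noteq> 0)"
proof -
  have "(\<Sum>i\<in>I_of \<alpha>. (x $ i) ^ (2 * beta \<alpha> i)) = 0 \<longleftrightarrow> (\<forall>i\<in>I_of \<alpha>. (x $ i) ^ (2 * beta \<alpha> i) = 0)"
    by (intro sum_nonneg_eq_0_iff) (auto simp: power_mult)
  also have "\<dots> \<longleftrightarrow> (\<forall>i\<in>I_of \<alpha>. x $ i = 0)"
    using beta_pos by auto
  finally show ?thesis
    using p_sum_nonneg[of x \<alpha>] by (auto simp: p_fun_def powr_eq_0_iff zero_less_iff_neq_zero less_le)
qed

lemma p_fun_s_Lam: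
  assumes "s > 0"
  shows "p_fun \<alpha> (s_Lam \<alpha> s x) = s * p_fun \<alpha> x"
proof -
  have "(s_Lam \<alpha> s x $ i) ^ (2 * beta \<alpha> i) = s ^ (2 * c_of \<alpha>) * (x $ i) ^ (2 * beta \<alpha> i)"
    if "i \<in> I_of \<alpha>" for i
  proof -
    have "\<alpha> i * (2 * beta \<alpha> i) = 2 * c_of \<alpha>" using alpha_mult_beta[OF that] by simp
    then have "(s ^ \<alpha> i) ^ (2 * beta \<alpha> i) = s ^ (2 * c_of \<alpha>)"
      by (simp only: flip: power_mult)
    then show ?thesis by (simp add: s_Lam_def power_mult_distrib)
  qed
  then have "p_fun \<alpha> (s_Lam \<alpha> s x) = (s ^ (2 * c_of \<alpha>) * (\<Sum>i\<in>I_of \<alpha>. (x $ i) ^ (2 * beta \<alpha> i)))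
      powr (1 / (2 * real (c_of \<alpha>)))"
    by (simp add: p_fun_def sum_distrib_left)
  also have "\<dots> = s * p_fun \<alpha> x"
    using assms c_of_pos[of \<alpha>]
    by (simp add: powr_mult p_sum_nonneg p_fun_def powr_powr flip: powr_realpow)
  finally show ?thesis .
qed

lemma strictly_differentiable_p_fun:
  assumes "0 < p_fun \<alpha> y"
  shows "strictly_differentiable (p_fun \<alpha>) y"
proof -
  have "0 < (\<Sum>i\<in>I_of \<alpha>. (y $ i) ^ (2 * beta \<alpha> i))"
    using assms p_sum_nonneg[of y \<alpha>] by (auto simp: p_fun_def less_le)
  then show ?thesis
    unfolding p_fun_def[abs_def]
    by (intro strictly_differentiable_intros strictly_differentiable_bounded_linear bounded_linear_vec_nth)
qed

text \<open>For \<open>p_fun \<alpha> x = 1 / \<nu>\<close> and \<open>m = 2 * c_of \<alpha>\<close> the expression \<open>\<nu> * (1 - inverse \<nu> ^ m)\<close> is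
  \<open>\<nu> / kappa \<alpha> x\<close>; in the variables \<open>(\<sigma>, Y)\<close> it has to be \<open>\<sigma> / p_fun \<alpha> Y\<close>. The equation can be solved for \<open>\<nu>\<close> since the left-hand side \<open>\<nu> - inverse \<nu> ^ (m - 1)\<close>
  expands distances. Solving it also for negative \<open>s\<close>, beyond the horizon, makes \<open>0\<close> an interior
  point of the domain of \<open>\<phi>\<close>.\<close>

lemma horizon_inverse_function:
  assumes "m \<ge> 2"
  obtains \<phi> :: "real \<Rightarrow> real" where "strictly_differentiable \<phi> 0" "\<phi> 0 = 1"
    and "\<And>s. \<bar>s\<bar> < 1 \<Longrightarrow> \<phi> s > 0 \<and> \<phi> s * (1 - inverse (\<phi> s) ^ m) = s"
proof -
  define \<eta> :: "real \<Rightarrow> real" where "\<eta> x = x * (1 + (- 1) * inverse x ^ m)" for x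
  obtain n where n: "m = Suc n" using assms by (cases m) auto
  have \<eta>_eq: "\<eta> x = x - inverse x ^ n" if "x > 0" for x
    using that by (simp add: \<eta>_def n field_simps)
  have expand: "y - x \<le> \<eta> y - \<eta> x" if "0 < x" "x \<le> y" for x y
  proof -
    have "inverse y ^ n \<le> inverse x ^ n"
      using that by (intro power_mono) (auto simp: le_imp_inverse_le)
    then show ?thesis using that by (simp add: \<eta>_eq)
  qed
  have ex: "\<exists>x. x > 0 \<and> \<eta> x = s" if "\<bar>s\<bar> < 1" for s
  proof -
    have pow: "(4 :: real) \<le> 2 ^ m"
      using power_increasing[OF assms, of "2 :: real"] by simp
    have "\<exists>x. 1 / 2 \<le> x \<and> x \<le> 2 \<and> \<eta> x = s"
    proof (rule IVT')
      define Q :: real where "Q = 2 ^ m"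
      have "\<eta> (1 / 2) = (1 - Q) / 2"
        unfolding \<eta>_def Q_def by simp
      moreover have "Q \<ge> 4" using pow by (simp add: Q_def)
      ultimately show "\<eta> (1 / 2) \<le> s" using that by simp
      define q :: real where "q = inverse 2 ^ m"
      have "q = inverse (2 ^ m)" unfolding q_def by (rule power_inverse)
      also have "\<dots> \<le> inverse 4" by (rule le_imp_inverse_le[OF pow zero_less_numeral])
      finally have "q \<le> 1 / 4" by simp
      moreover have "\<eta> 2 = 2 - 2 * q"
        by (simp add: \<eta>_def q_def)
      ultimately show "s \<le> \<eta> 2" using that by simp
      show "continuous_on {1 / 2..2} \<eta>"
        unfolding \<eta>_def by (auto intro!: continuous_intros)
    qed simp
    then obtain x where "1 / 2 \<le> x" "\<eta> x = s" by blast
    then show ?thesis by (intro exI[of _ x]) simp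
  qed
  define \<phi> where "\<phi> s = (SOME x. x > 0 \<and> \<eta> x = s)" for s
  have \<phi>: "\<phi> s > 0 \<and> \<eta> (\<phi> s) = s" if "\<bar>s\<bar> < 1" for s
    unfolding \<phi>_def by (rule someI_ex) (rule ex[OF that])
  have lip: "\<bar>\<phi> s - \<phi> s'\<bar> \<le> \<bar>s - s'\<bar>" if "\<bar>s\<bar> < 1" "\<bar>s'\<bar> < 1" for s s'
    using expand[of "\<phi> s" "\<phi> s'"] expand[of "\<phi> s'" "\<phi> s"] \<phi>[OF that(1)] \<phi>[OF that(2)] by linarith
  have \<phi>0: "\<phi> 0 = 1"
  proof -
    have "\<eta> 1 = 0" by (simp add: \<eta>_def)
    then show ?thesis
      using expand[of "\<phi> 0" 1] expand[of 1 "\<phi> 0"] \<phi>[of 0] by linarith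
  qed
  show ?thesis
  proof (rule that[of \<phi>])
    show "\<phi> 0 = 1" by (rule \<phi>0)
    have "strictly_differentiable (\<lambda>x :: real. x) 1"
      by (intro strictly_differentiable_bounded_linear bounded_linear_ident)
    then have "strictly_differentiable \<eta> 1"
      unfolding \<eta>_def by (intro strictly_differentiable_intros) auto
    then show "strictly_differentiable \<phi> 0"
    proof (rule strictly_differentiable_local_inverse[where d = 1])
      show "\<eta> (\<phi> s) = s" if "\<bar>s - 0\<bar> < 1" for s
        using \<phi>[of s] that by simp
      show "\<bar>\<phi> s - \<phi> s'\<bar> \<le> \<bar>s - s'\<bar>" if "\<bar>s - 0\<bar> < 1" "\<bar>s' - 0\<bar> < 1" for s s'
        using lip[of s s'] that by simp
    qed (use \<phi>0 in simp_all)
    show "\<phi> s > 0 \<and> \<phi> s * (1 - inverse (\<phi> s) ^ m) = s" if "\<bar>s\<bar> < 1" for s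
      using \<phi>[OF that] by (simp add: \<eta>_def)
  qed
qed

text \<open>Along the curve \<open>\<nu> \<mapsto> (t, s_Lam \<alpha> \<nu> x)\<close>, which reaches the horizon point \<open>(t, x)\<close> as \<open>\<nu>\<close> increases
  to \<open>1\<close>, the transform of the residual \<open>f - fk\<close> is \<open>F - fk\<close>, because homogeneity makes the transform of
  \<open>fk\<close> equal to \<open>fk\<close>. Assumption (R) makes it tend to \<open>0\<close>.\<close>

lemma extension_eq_on_horizon:
  fixes F f fk :: "real \<times> (real ^ 'n::finite) \<Rightarrow> real ^ 'n"
  assumes cyl: "cylinder_domain \<alpha> U" and R: "assumption_R \<alpha> k U f fk"
    and qh: "asymp_quasi_homogeneous \<alpha> k U f fk"
    and F: "\<And>z. z \<in> inner_region \<alpha> U \<Longrightarrow> F z = tilde \<alpha> k f z"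
    and z: "z \<in> horizon \<alpha> U" and cont: "isCont F z" "isCont fk z"
  shows "F z = fk z"
proof -
  obtain t x where tx: "z = (t, x)" by (cases z)
  have x: "x \<in> U" "p_fun \<alpha> x = 1" using z tx by (auto simp: horizon_def)
  define m where "m = 2 * c_of \<alpha>"
  have m: "m > 0" using c_of_pos[of \<alpha>] by (simp add: m_def)
  define \<gamma> where "\<gamma> \<nu> = (t, s_Lam \<alpha> \<nu> x)" for \<nu>
  have ev: "\<forall>\<^sub>F \<nu> in at_left 1. \<nu> \<in> {0<..<1::real}"
    using eventually_at_left_field[of _ "1 :: real"] by (auto intro!: exI[of _ 0])
  have inner: "\<gamma> \<nu> \<in> inner_region \<alpha> U" if "\<nu> \<in> {0<..<1}" for \<nu>
    using that x s_Lam_in_cylinder[OF cyl x(1)] by (auto simp: \<gamma>_def inner_region_def p_fun_s_Lam)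
  have "isCont \<gamma> 1"
    unfolding \<gamma>_def s_Lam_def isCont_def
    by (intro tendsto_Pair tendsto_vec_lambda tendsto_mult tendsto_power tendsto_ident_at tendsto_const)
  then have \<gamma>_lim: "(\<gamma> \<longlongrightarrow> z) (at_left 1)"
    by (auto simp: isCont_def \<gamma>_def tx filterlim_at_split)
  have \<gamma>_filter: "filterlim \<gamma> (at z within inner_region \<alpha> U) (at_left 1)"
    unfolding filterlim_at
  proof
    show "\<forall>\<^sub>F \<nu> in at_left 1. \<gamma> \<nu> \<in> inner_region \<alpha> U \<and> \<gamma> \<nu> \<noteq> z"
      using ev by eventually_elim (use inner x(2) in \<open>force simp: tx inner_region_def\<close>)
  qed (rule \<gamma>_lim)
  have kap: "kappa \<alpha> (s_Lam \<alpha> \<nu> x) = inverse (1 - \<nu> ^ m)" "1 - \<nu> ^ m > 0" if "\<nu> \<in> {0<..<1}" for \<nu>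
    using that x(2) m by (auto simp: kappa_def p_fun_s_Lam m_def power_less_one_iff)
  obtain \<epsilon> where "\<epsilon> > 0" and \<epsilon>: "\<And>i. (\<lambda>w. tilde \<alpha> k (\<lambda>w. f w - fk w) w $ i)
      \<in> O[at z within inner_region \<alpha> U](\<lambda>(t, x). kappa \<alpha> x powr (- (1 + \<epsilon>)))"
    using R z unfolding assumption_R_def Let_def by blast
  have "((\<lambda>\<nu>. F (\<gamma> \<nu>) $ i - fk (\<gamma> \<nu>) $ i) \<longlongrightarrow> 0) (at_left 1)" for i
  proof -
    obtain C where C: "C > 0" "\<forall>\<^sub>F w in at z within inner_region \<alpha> U.
        norm (tilde \<alpha> k (\<lambda>w. f w - fk w) w $ i) \<le> C * norm ((\<lambda>(t, x). kappa \<alpha> x powr (- (1 + \<epsilon>))) w)"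
      using \<epsilon>[of i] by (elim landau_o.bigE) blast
    show ?thesis
    proof (rule Lim_null_comparison)
      from eventually_compose_filterlim[OF C(2) \<gamma>_filter] ev
      show "\<forall>\<^sub>F \<nu> in at_left 1. norm (F (\<gamma> \<nu>) $ i - fk (\<gamma> \<nu>) $ i) \<le> C * (1 - \<nu> ^ m) powr (1 + \<epsilon>)"
      proof eventually_elim
        case (elim \<nu>)
        let ?y = "s_Lam \<alpha> \<nu> x"
        have kpos: "kappa \<alpha> ?y > 0" using kap[OF elim(2)] by simp
        have yU: "?y \<in> U" by (rule s_Lam_in_cylinder[OF cyl x(1)])
        have "fk (t, s_Lam \<alpha> (kappa \<alpha> ?y) ?y) $ i = kappa \<alpha> ?y powr (k + real (\<alpha> i)) * fk (t, ?y) $ i"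
          using qh kpos yU unfolding asymp_quasi_homogeneous_def by blast
        then have "tilde \<alpha> k (\<lambda>w. f w - fk w) (\<gamma> \<nu>) $ i = F (\<gamma> \<nu>) $ i - fk (\<gamma> \<nu>) $ i"
          using F[OF inner[OF elim(2)]] kpos
          by (simp add: tilde_def \<gamma>_def algebra_simps flip: powr_add mult.assoc)
        moreover have "kappa \<alpha> ?y powr (- (1 + \<epsilon>)) = (1 - \<nu> ^ m) powr (1 + \<epsilon>)"
          unfolding kap(1)[OF elim(2)] powr_minus inverse_powr by (rule inverse_inverse_eq)
        ultimately show ?case using elim(1) by (simp add: \<gamma>_def)
      qed
      have "((\<lambda>\<nu>. C * (1 - \<nu> ^ m) powr (1 + \<epsilon>)) \<longlongrightarrow> C * (1 - 1 ^ m) powr (1 + \<epsilon>)) (at_left (1::real))"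
        using \<open>\<epsilon> > 0\<close> by (intro tendsto_intros) (auto intro: eventually_mono[OF ev] simp: power_le_one)
      then show "((\<lambda>\<nu>. C * (1 - \<nu> ^ m) powr (1 + \<epsilon>)) \<longlongrightarrow> 0) (at_left 1)" using \<open>\<epsilon> > 0\<close> by simp
    qed
  qed
  moreover have "((\<lambda>\<nu>. F (\<gamma> \<nu>) $ i - fk (\<gamma> \<nu>) $ i) \<longlongrightarrow> F z $ i - fk z $ i) (at_left 1)" for i
    using isCont_tendsto_compose[OF cont(1) \<gamma>_lim] isCont_tendsto_compose[OF cont(2) \<gamma>_lim]
    by (intro tendsto_intros)
  ultimately have "F z $ i - fk z $ i = 0" for i
    using tendsto_unique[OF trivial_limit_at_left_real] by blast
  then show ?thesis by (simp add: vec_eq_iff)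
qed


section \<open>The rescaled field up to the horizon\<close>

context
  fixes \<alpha> :: "'n::finite \<Rightarrow> nat" and k :: real and \<phi> :: "real \<Rightarrow> real"
    and F :: "real \<times> (real ^ 'n) \<Rightarrow> real ^ 'n"
begin

text \<open>If \<open>\<phi>\<close> is the function from \<open>horizon_inverse_function\<close>, this is the \<open>\<mu>\<close> depending on
  \<open>(\<sigma>, t, Y)\<close>, with small \<open>\<sigma> > 0\<close>, for which \<open>x = s_Lam \<alpha> (1 / \<mu>) Y\<close> satisfies \<open>kappa \<alpha> x = \<mu> / \<sigma>\<close>, so that
  \<open>x\<close> is the compactified coordinate of the point \<open>s_Lam \<alpha> (1 / \<sigma>) Y\<close>.\<close>

definition scaling_factor :: "real \<times> real \<times> (real ^ 'n) \<Rightarrow> real" where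
  "scaling_factor z = \<phi> (fst z * inverse (p_fun \<alpha> (snd (snd z)))) * p_fun \<alpha> (snd (snd z))"

text \<open>For \<open>\<sigma> > 0\<close> this is \<open>f\<close> seen at the scale \<open>1 / \<sigma>\<close>, but expressed by the extension \<open>F\<close>, which makes
  sense for \<open>\<sigma> \<le> 0\<close> as well.\<close>

definition rescaled_field :: "real \<times> real \<times> (real ^ 'n) \<Rightarrow> real ^ 'n" where
  "rescaled_field z = (\<chi> i. scaling_factor z powr (k + real (\<alpha> i)) *
     F (fst (snd z), s_Lam \<alpha> (inverse (scaling_factor z)) (snd (snd z))) $ i)"

text \<open>At the base point the argument of \<open>F\<close> is a point of the horizon, so the field is composed of \<open>F\<close> near
  that point, of \<open>\<phi>\<close> near \<open>0\<close>, and of powers with positive base.\<close>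

lemma strictly_differentiable_rescaled_field:
  assumes \<phi>: "strictly_differentiable \<phi> 0" "\<phi> 0 = 1" and Y: "0 < p_fun \<alpha> Y"
    and F: "strictly_differentiable F (t, s_Lam \<alpha> (inverse (p_fun \<alpha> Y)) Y)"
  shows "strictly_differentiable rescaled_field (0, t, Y)"
proof -
  let ?a = "(0, t, Y) :: real \<times> real \<times> (real ^ 'n)"
  have proj: "strictly_differentiable fst ?a" "strictly_differentiable (\<lambda>z. fst (snd z)) ?a"
    "strictly_differentiable (\<lambda>z. snd (snd z)) ?a" "strictly_differentiable (\<lambda>z. snd (snd z) $ i) ?a" for i
    by (intro strictly_differentiable_bounded_linear bounded_linear_fst bounded_linear_snd
        bounded_linear_compose[OF bounded_linear_vec_nth]
        bounded_linear_compose[OF bounded_linear_fst] bounded_linear_compose[OF bounded_linear_snd])+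
  have p: "strictly_differentiable (\<lambda>z. p_fun \<alpha> (snd (snd z))) ?a"
    using strictly_differentiable_p_fun[OF Y] by (intro strictly_differentiable_compose[OF proj(3)]) simp
  have "strictly_differentiable (\<lambda>z. fst z * inverse (p_fun \<alpha> (snd (snd z)))) ?a"
    using Y by (intro strictly_differentiable_intros proj p) simp
  then have "strictly_differentiable (\<lambda>z. \<phi> (fst z * inverse (p_fun \<alpha> (snd (snd z))))) ?a"
    by (rule strictly_differentiable_compose) (use \<phi> in simp)
  then have mu: "strictly_differentiable scaling_factor ?a"
    unfolding scaling_factor_def[abs_def] by (intro strictly_differentiable_intros p)
  have mu0: "scaling_factor ?a = p_fun \<alpha> Y" by (simp add: scaling_factor_def \<phi>)
  have "strictly_differentiable (\<lambda>z. s_Lam \<alpha> (inverse (scaling_factor z)) (snd (snd z))) ?a"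
    by (rule strictly_differentiable_vec)
       (use mu0 Y in \<open>auto simp: s_Lam_def intro!: strictly_differentiable_intros proj mu\<close>)
  then have "strictly_differentiable (\<lambda>z. (fst (snd z), s_Lam \<alpha> (inverse (scaling_factor z)) (snd (snd z)))) ?a"
    by (intro strictly_differentiable_intros proj)
  then have "strictly_differentiable (\<lambda>z. F (fst (snd z), s_Lam \<alpha> (inverse (scaling_factor z)) (snd (snd z)))) ?a"
    by (rule strictly_differentiable_compose) (use F mu0 in simp)
  then have "strictly_differentiable (\<lambda>z. F (fst (snd z), s_Lam \<alpha> (inverse (scaling_factor z)) (snd (snd z))) $ i) ?a" for i
    by (rule strictly_differentiable_compose)
       (intro strictly_differentiable_bounded_linear bounded_linear_vec_nth)
  then show ?thesis
    by (intro strictly_differentiable_vec)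
       (use mu0 Y in \<open>auto simp: rescaled_field_def intro!: strictly_differentiable_intros mu\<close>)
qed

text \<open>The scaling factor is chosen so that the powers of \<open>\<mu>\<close> and of \<open>kappa \<alpha> x = \<mu> / \<sigma>\<close> combine to powers
  of \<open>\<sigma>\<close>.\<close>

lemma rescaled_field_pos:
  assumes cyl: "cylinder_domain \<alpha> U"
    and \<phi>: "\<And>s. \<bar>s\<bar> < 1 \<Longrightarrow> \<phi> s > 0 \<and> \<phi> s * (1 - inverse (\<phi> s) ^ (2 * c_of \<alpha>)) = s"
    and F: "\<And>z. z \<in> inner_region \<alpha> U \<Longrightarrow> F z = tilde \<alpha> k f z"
    and Y: "Y \<in> U" and \<sigma>: "0 < \<sigma>" "\<sigma> < p_fun \<alpha> Y"
  shows "rescaled_field (\<sigma>, t, Y) $ i = \<sigma> powr (k + real (\<alpha> i)) * f (t, s_Lam \<alpha> (inverse \<sigma>) Y) $ i"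
proof -
  define p where "p = p_fun \<alpha> Y"
  have p: "p > 0" using \<sigma> by (simp add: p_def)
  define s where "s = \<sigma> * inverse p"
  have s: "0 < s" "s < 1" using \<sigma> p by (auto simp: s_def p_def field_simps)
  define \<nu> where "\<nu> = \<phi> s"
  define \<mu> where "\<mu> = \<nu> * p"
  define x where "x = s_Lam \<alpha> (inverse \<mu>) Y"
  have \<nu>: "\<nu> > 0" "\<nu> * (1 - inverse \<nu> ^ (2 * c_of \<alpha>)) = s"
    using \<phi>[of s] s by (auto simp: \<nu>_def)
  have \<mu>: "\<mu> > 0" using \<nu> p by (simp add: \<mu>_def)
  have pos: "1 - inverse \<nu> ^ (2 * c_of \<alpha>) > 0"
    using \<nu> s by (metis zero_less_mult_pos)
  then have "inverse \<nu> < 1"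
    using \<nu>(1) c_of_pos[of \<alpha>] by (simp add: power_less_one_iff)
  moreover have px: "p_fun \<alpha> x = inverse \<nu>"
    unfolding x_def using \<mu> p \<nu>(1) by (subst p_fun_s_Lam) (auto simp: \<mu>_def p_def[symmetric])
  moreover have "x \<in> U" unfolding x_def by (rule s_Lam_in_cylinder[OF cyl Y])
  ultimately have "F (t, x) = tilde \<alpha> k f (t, x)"
    by (intro F) (simp add: inner_region_def)
  moreover have kap: "kappa \<alpha> x = \<mu> / \<sigma>"
  proof -
    have "1 - inverse \<nu> ^ (2 * c_of \<alpha>) = \<sigma> / \<mu>"
      using \<nu> p by (simp add: \<mu>_def s_def field_simps)
    then show ?thesis by (simp add: kappa_def px)
  qed
  moreover have "s_Lam \<alpha> (\<mu> / \<sigma>) x = s_Lam \<alpha> (inverse \<sigma>) Y"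
    unfolding x_def s_Lam_s_Lam using \<mu> by (simp add: field_simps)
  ultimately have "F (t, x) $ i = (\<mu> / \<sigma>) powr (- (k + real (\<alpha> i))) * f (t, s_Lam \<alpha> (inverse \<sigma>) Y) $ i"
    by (simp add: tilde_def)
  moreover have "\<mu> powr (k + real (\<alpha> i)) * (\<mu> / \<sigma>) powr (- (k + real (\<alpha> i))) = \<sigma> powr (k + real (\<alpha> i))"
  proof -
    have "\<mu> powr b * (\<mu> / \<sigma>) powr (- b) = \<sigma> powr b" for b
    proof -
      have "\<mu> powr b * (\<mu> / \<sigma>) powr (- b) = (\<mu> * inverse (\<mu> / \<sigma>)) powr b"
        by (metis powr_mult inverse_powr powr_minus)
      then show ?thesis using \<mu> by simp
    qed
    then show ?thesis .
  qed
  moreover have "scaling_factor (\<sigma>, t, Y) = \<mu>"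
    by (simp add: scaling_factor_def \<mu>_def \<nu>_def s_def p_def)
  ultimately show ?thesis
    by (simp add: rescaled_field_def x_def[symmetric] flip: mult.assoc)
qed

text \<open>At \<open>\<sigma> = 0\<close> the compactified coordinate is the point of the horizon on the orbit of \<open>Y\<close> under the
  scaling, and the homogeneity of \<open>fk\<close> transports its value there back to \<open>Y\<close>.\<close>

lemma rescaled_field_0:
  assumes cyl: "cylinder_domain \<alpha> U" and \<phi>: "\<phi> 0 = 1"
    and qh: "asymp_quasi_homogeneous \<alpha> k U f fk"
    and Y: "Y \<in> U" "0 < p_fun \<alpha> Y"
    and F: "F (t, s_Lam \<alpha> (inverse (p_fun \<alpha> Y)) Y) = fk (t, s_Lam \<alpha> (inverse (p_fun \<alpha> Y)) Y)"
  shows "rescaled_field (0, t, Y) = fk (t, Y)"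
proof -
  let ?s = "inverse (p_fun \<alpha> Y)"
  have "?s > 0" using Y by simp
  then have "fk (t, s_Lam \<alpha> ?s Y) $ i = ?s powr (k + real (\<alpha> i)) * fk (t, Y) $ i" for i
    using qh Y(1) unfolding asymp_quasi_homogeneous_def by blast
  moreover have "p_fun \<alpha> Y powr b * ?s powr b = 1" for b
    using Y(2) by (simp flip: powr_mult)
  ultimately show ?thesis
    by (simp add: vec_eq_iff rescaled_field_def scaling_factor_def \<phi> F flip: mult.assoc)
qed

end

section \<open>Blow-up solutions\<close>

lemma has_vector_derivative_vecI:
  fixes y :: "real \<Rightarrow> real ^ 'n"
  assumes "\<And>i. ((\<lambda>t. y t $ i) has_real_derivative w $ i) (at t)"
  shows "(y has_vector_derivative w) (at t)"
  unfolding has_vector_derivative_def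
  by (subst has_derivative_componentwise_within)
     (use assms in \<open>auto simp: Basis_vec_def inner_axis has_field_derivative_def mult_commute_abs\<close>)

lemma Lam_mult_component: "(Lam \<alpha> *v v) $ i = real (\<alpha> i) * v $ i"
  by (simp add: Lam_def matrix_vector_mult_def if_distrib [of "\<lambda>u. u * _"] cong: if_cong)

lemma A_mat_mult: "A_mat \<alpha> k fk t Y *v v =
    (- 1 / k) *\<^sub>R (Lam \<alpha> *v v) + jacobian (\<lambda>y. fk (t, y)) (at Y) *v v"
  by (simp only: A_mat_def matrix_vector_mult_add_rdistrib scaleR_matrix_vector_assoc)

lemma kernel_imp_0_in_Spec:
  fixes A :: "real ^ 'n ^ 'n"
  assumes "A *v v = 0" "v \<noteq> 0"
  shows "0 \<in> Spec A"
proof -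
  define w :: "complex ^ 'n" where "w = (\<chi> i. of_real (v $ i))"
  have "complex_mat A *v w = (\<chi> i. of_real ((A *v v) $ i))"
    by (simp add: w_def complex_mat_def matrix_vector_mult_def vec_eq_iff)
  then have "complex_mat A *v w = 0 *s w" using assms by (simp add: vec_eq_iff)
  moreover have "w \<noteq> 0" using assms(2) by (auto simp: w_def vec_eq_iff)
  ultimately show ?thesis by (auto simp: Spec_def)
qed

text \<open>If all coordinates of \<open>Y\<close> in \<open>I_of \<alpha>\<close> vanish, then the scaling fixes the multiples of \<open>Y\<close>,
  homogeneity forces \<open>fk\<close> to vanish on them, and \<open>Y\<close> itself lies in the kernel of \<open>A\<close>.\<close>

lemma hyperbolic_root_p_fun_pos:
  fixes fk :: "real \<times> (real ^ 'n::finite) \<Rightarrow> real ^ 'n"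
  assumes cyl: "cylinder_domain \<alpha> U" and qh: "asymp_quasi_homogeneous \<alpha> k U f fk"
    and Y: "Y \<in> U" "Y \<noteq> 0" and diff: "(\<lambda>y. fk (t, y)) differentiable (at Y)"
    and hyp: "0 \<notin> Spec (A_mat \<alpha> k fk t Y)"
  shows "0 < p_fun \<alpha> Y"
proof (rule ccontr)
  assume "\<not> 0 < p_fun \<alpha> Y"
  then have Y0: "\<And>i. i \<in> I_of \<alpha> \<Longrightarrow> Y $ i = 0" by (auto simp: p_fun_pos_iff)
  have fixed: "s_Lam \<alpha> s (c *\<^sub>R Y) = c *\<^sub>R Y" for s c
  proof -
    have "s ^ \<alpha> i * Y $ i = Y $ i" for i
      using Y0[of i] by (cases "\<alpha> i = 0") (auto simp: I_of_def)
    then show ?thesis by (simp add: s_Lam_def vec_eq_iff mult.left_commute)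
  qed
  define l where "l h = Y + h *\<^sub>R Y" for h :: real
  have l: "l h = (1 + h) *\<^sub>R Y" for h by (simp add: l_def scaleR_left_distrib)
  have k: "k > 0" using qh by (simp add: asymp_quasi_homogeneous_def)
  have zero: "fk (t, l h) = 0" if "l h \<in> U" for h
  proof -
    have "fk (t, l h) $ i = 0" for i
    proof -
      have "\<forall>s>0. fk (t, s_Lam \<alpha> s (l h)) $ i = s powr (k + real (\<alpha> i)) * fk (t, l h) $ i"
        using qh that by (simp add: asymp_quasi_homogeneous_def)
      then have "fk (t, l h) $ i = 2 powr (k + real (\<alpha> i)) * fk (t, l h) $ i"
        by (metis fixed l zero_less_numeral)
      moreover have "2 powr (k + real (\<alpha> i)) > 1"
        using k by (intro gr_one_powr) auto
      ultimately show ?thesis by auto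
    qed
    then show ?thesis by (simp add: vec_eq_iff)
  qed
  let ?J = "jacobian (\<lambda>y. fk (t, y)) (at Y)"
  have "((\<lambda>y. fk (t, y)) has_derivative (\<lambda>h. ?J *v h)) (at (l 0))"
    using diff by (simp add: jacobian_works l_def)
  moreover have "(l has_derivative (\<lambda>h. h *\<^sub>R Y)) (at 0)"
    unfolding l_def by (auto intro!: derivative_eq_intros)
  ultimately have 1: "((\<lambda>h. fk (t, l h)) has_derivative (\<lambda>h. ?J *v (h *\<^sub>R Y))) (at 0)"
    using diff_chain_at[of l _ 0 "\<lambda>y. fk (t, y)"] by (simp add: o_def)
  have "open (l -` U)"
    using cyl unfolding cylinder_domain_def l_def
    by (intro open_vimage) (auto intro!: continuous_intros)
  then have 2: "((\<lambda>h. fk (t, l h)) has_derivative (\<lambda>_. 0)) (at 0)"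
    using Y(1) zero by (intro has_derivative_transform_within_open[OF has_derivative_const[of 0]])
      (auto simp: l_def)
  have "?J *v (1 *\<^sub>R Y) = 0"
    using has_derivative_unique[OF 1 2] by (simp only: fun_eq_iff)
  moreover have "Lam \<alpha> *v Y = 0"
    using Y0 by (auto simp: vec_eq_iff Lam_mult_component I_of_def)
  ultimately have "A_mat \<alpha> k fk t Y *v Y = 0" by (simp add: A_mat_mult)
  with kernel_imp_0_in_Spec Y(2) hyp show False by blast
qed

lemma tendsto_exp_neg_mult_at_top:
  assumes "c > (0 :: real)"
  shows "((\<lambda>\<tau>. exp (- \<tau> / c)) \<longlongrightarrow> 0) at_top"
proof -
  have "filterlim (\<lambda>\<tau>. - \<tau> / c) at_bot at_top"
  proof -
    have "filterlim (\<lambda>\<tau>. (- 1 / c) * \<tau>) at_bot at_top"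
      using assms by (intro filterlim_tendsto_neg_mult_at_bot[OF tendsto_const _ filterlim_ident]) auto
    then show ?thesis by simp
  qed
  then show ?thesis by (rule filterlim_compose[OF exp_at_bot])
qed

text \<open>The equation for \<open>Y\<close> is \<open>y' = f(t, y)\<close> in the variables \<open>\<tau> = - ln (tstar - t)\<close> and
  \<open>y = s_Lam \<alpha> (exp (\<tau> / k)) Y\<close>. Its right-hand side is \<open>V(\<sigma>, t, Y) - \<Lambda> Y / k\<close> with \<open>\<sigma> = exp (- \<tau> / k)\<close>
  and the rescaled field \<open>V\<close>, and \<open>(\<sigma>, t)\<close> tends to \<open>(0, tstar)\<close>. Strict differentiability of \<open>V\<close> at
  \<open>(0, tstar, Y0)\<close> says that, after the linear part at \<open>Y0\<close> is split off, the remainder has a small Lipschitz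
  constant in \<open>Y\<close>. As \<open>V(0, tstar, \<cdot>)\<close> is \<open>fk(tstar, \<cdot>)\<close>, that linear part and
  \<open>- \<Lambda> / k\<close> add up to \<open>A\<close>, and the balance law says that \<open>Y0\<close> is an equilibrium of the limiting equation.\<close>

theorem rescaled_solution_exists:
  fixes f fk :: "real \<times> (real ^ 'n::finite) \<Rightarrow> real ^ 'n"
    and \<alpha> :: "'n \<Rightarrow> nat" and k :: real and U :: "(real ^ 'n) set" and r :: nat
    and tstar :: real and Y0 :: "real ^ 'n"
  assumes cyl: "cylinder_domain \<alpha> U"
    and r: "r \<ge> 1"
    and f: "continuous_on (UNIV \<times> U) f"
    and qh: "asymp_quasi_homogeneous \<alpha> k U f fk"
    and fk: "continuous_on (UNIV \<times> {y \<in> U. \<exists>i\<in>I_of \<alpha>. y $ i \<noteq> 0}) fk"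
    and ext: "tilde_extends r \<alpha> k U f"
    and R: "assumption_R \<alpha> k U f fk"
    and Y0: "Y0 \<in> U" "0 < p_fun \<alpha> Y0"
    and diff: "(\<lambda>y. fk (tstar, y)) differentiable (at Y0)"
    and balance: "(- 1 / k) *\<^sub>R (Lam \<alpha> *v Y0) + fk (tstar, Y0) = 0"
    and hyp: "Spec (A_mat \<alpha> k fk tstar Y0) \<inter> {z. Re z = 0} = {}"
  obtains Y T where "(Y \<longlongrightarrow> Y0) at_top"
    and "\<And>\<tau>. \<tau> > T \<Longrightarrow> Y \<tau> \<in> U"
    and "\<And>\<tau> i. \<tau> > T \<Longrightarrow> ((\<lambda>\<tau>. Y \<tau> $ i) has_real_derivative
      - (real (\<alpha> i) / k) * Y \<tau> $ i + exp (- \<tau> / k) powr (k + real (\<alpha> i)) *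
        f (tstar - exp (- \<tau>), s_Lam \<alpha> (inverse (exp (- \<tau> / k))) (Y \<tau>)) $ i) (at \<tau>)"
proof -
  have k: "k > 0" using qh by (simp add: asymp_quasi_homogeneous_def)
  have "open U" using cyl by (simp add: cylinder_domain_def)
  obtain W F where W: "open W" "inner_region \<alpha> U \<union> horizon \<alpha> U \<subseteq> W"
    and F_Cr: "C_r_on r F W" and F_tilde: "\<And>z. z \<in> inner_region \<alpha> U \<Longrightarrow> F z = tilde \<alpha> k f z"
    using ext unfolding tilde_extends_def by blast
  have F_sd: "strictly_differentiable F z" if "z \<in> horizon \<alpha> U" for z
    using that W by (intro C_r_on_imp_strictly_differentiable[OF F_Cr r]) auto
  have fk_cont: "isCont fk z" if "z \<in> horizon \<alpha> U" for z
  proof -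
    have eq: "{y \<in> U. \<exists>i\<in>I_of \<alpha>. y $ i \<noteq> 0} = U \<inter> (\<Union>i\<in>I_of \<alpha>. {y. y $ i \<noteq> 0})" by auto
    have "open (UNIV \<times> {y \<in> U. \<exists>i\<in>I_of \<alpha>. y $ i \<noteq> 0} :: (real \<times> (real ^ 'n)) set)"
      unfolding eq using \<open>open U\<close>
      by (intro open_Times open_Int open_UN ballI open_Collect_neq continuous_intros) auto
    moreover have "z \<in> UNIV \<times> {y \<in> U. \<exists>i\<in>I_of \<alpha>. y $ i \<noteq> 0}"
      using that p_fun_pos_iff[of \<alpha> "snd z"] by (auto simp: horizon_def)
    ultimately show ?thesis using fk continuous_on_eq_continuous_at by blast
  qed
  have F_fk: "F z = fk z" if "z \<in> horizon \<alpha> U" for z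
    using extension_eq_on_horizon[OF cyl R qh F_tilde that] fk_cont[OF that]
      strictly_differentiable_imp_isCont[OF F_sd[OF that]] by blast
  obtain \<phi> :: "real \<Rightarrow> real" where \<phi>: "strictly_differentiable \<phi> 0" "\<phi> 0 = 1"
    "\<And>s. \<bar>s\<bar> < 1 \<Longrightarrow> \<phi> s > 0 \<and> \<phi> s * (1 - inverse (\<phi> s) ^ (2 * c_of \<alpha>)) = s"
    using horizon_inverse_function[of "2 * c_of \<alpha>"] c_of_pos[of \<alpha>] by auto
  have to_horizon: "(t, s_Lam \<alpha> (inverse (p_fun \<alpha> Y)) Y) \<in> horizon \<alpha> U"
    if "Y \<in> U" "0 < p_fun \<alpha> Y" for t Y
    using that s_Lam_in_cylinder[OF cyl] by (simp add: horizon_def p_fun_s_Lam)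

  let ?V = "rescaled_field \<alpha> k \<phi> F"
  define a where "a = (0 :: real, tstar, Y0)"
  have V_sd: "strictly_differentiable ?V a"
    unfolding a_def
    by (intro strictly_differentiable_rescaled_field \<phi>(1,2) Y0(2) F_sd to_horizon Y0)
  have V0: "?V (0, t, Y) = fk (t, Y)" if "Y \<in> U" "0 < p_fun \<alpha> Y" for t Y
    by (rule rescaled_field_0[of \<alpha> U \<phi>]) (use cyl \<phi>(2) qh that F_fk[OF to_horizon] in auto)
  have Vpos: "?V (\<sigma>, t, Y) $ i = \<sigma> powr (k + real (\<alpha> i)) * f (t, s_Lam \<alpha> (inverse \<sigma>) Y) $ i"
    if "Y \<in> U" "0 < \<sigma>" "\<sigma> < p_fun \<alpha> Y" for \<sigma> t Y i
    by (rule rescaled_field_pos[OF cyl \<phi>(3) F_tilde that]) auto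

  have p_cont: "isCont (p_fun \<alpha>) Y0"
    by (intro strictly_differentiable_imp_isCont strictly_differentiable_p_fun Y0)
  \<comment> \<open>For \<open>\<sigma> < p0\<close> the formula for positive \<open>\<sigma>\<close> is available on a whole ball around \<open>Y0\<close>.\<close>
  define p0 where "p0 = p_fun \<alpha> Y0 / 2"
  have p0: "p0 > 0" using Y0 by (simp add: p0_def)
  have "\<forall>\<^sub>F y in nhds Y0. y \<in> U \<and> p0 < p_fun \<alpha> y"
  proof (rule eventually_conj)
    show "\<forall>\<^sub>F y in nhds Y0. y \<in> U" using \<open>open U\<close> Y0 by (intro eventually_nhds_in_open)
    have "(p_fun \<alpha> \<longlongrightarrow> p_fun \<alpha> Y0) (nhds Y0)"
      using p_cont by (simp add: isCont_def tendsto_nhds_iff)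
    then show "\<forall>\<^sub>F y in nhds Y0. p0 < p_fun \<alpha> y"
      by (rule order_tendstoD) (use Y0 in \<open>simp add: p0_def\<close>)
  qed
  then obtain \<rho>' where \<rho>': "\<rho>' > 0" "\<And>y. dist y Y0 < \<rho>' \<Longrightarrow> y \<in> U \<and> p0 < p_fun \<alpha> y"
    unfolding eventually_nhds_metric by blast
  define \<rho> where "\<rho> = \<rho>' / 2"
  have \<rho>: "\<rho> > 0" using \<rho>' by (simp add: \<rho>_def)
  have near: "Y0 + z \<in> U" "p0 < p_fun \<alpha> (Y0 + z)" if "z \<in> cball 0 \<rho>" for z
    using \<rho>'(2)[of "Y0 + z"] that \<rho>'(1) by (auto simp: \<rho>_def dist_norm)

  let ?J = "jacobian (\<lambda>y. fk (tstar, y)) (at Y0)"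
  let ?A = "A_mat \<alpha> k fk tstar Y0"
  obtain L where L: "has_strict_derivative ?V L a"
    using V_sd by (auto simp: strictly_differentiable_def)
  \<comment> \<open>Only the derivative in the direction of \<open>Y\<close> enters, and that is read off at \<open>\<sigma> = 0\<close>.\<close>
  have LJ: "L (0, 0, v) = ?J *v v" for v
  proof -
    have "(?V has_derivative L) (at (0, tstar, Y0))"
      using has_strict_derivative_imp_has_derivative[OF L] by (simp add: a_def)
    moreover have "((\<lambda>y. (0 :: real, tstar, y)) has_derivative (\<lambda>v. (0, 0, v))) (at Y0)"
      by (intro has_derivative_Pair has_derivative_const has_derivative_ident)
    ultimately have 1: "((\<lambda>y. ?V (0, tstar, y)) has_derivative (\<lambda>v. L (0, 0, v))) (at Y0)"
      using diff_chain_at[of "\<lambda>y. (0 :: real, tstar, y)" _ Y0 ?V] by (simp add: o_def)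
    have "((\<lambda>y. fk (tstar, y)) has_derivative (\<lambda>v. L (0, 0, v))) (at Y0)"
    proof (rule has_derivative_transform_within[OF 1 \<rho>'(1)])
      show "?V (0, tstar, y) = fk (tstar, y)" if "dist y Y0 < \<rho>'" for y
        using \<rho>'(2)[OF that] p0 by (intro V0) auto
    qed simp
    moreover have "((\<lambda>y. fk (tstar, y)) has_derivative (\<lambda>v. ?J *v v)) (at Y0)"
      using diff by (simp add: jacobian_works)
    ultimately show ?thesis by (metis has_derivative_unique)
  qed

  define \<sigma> where "\<sigma> \<tau> = exp (- \<tau> / k)" for \<tau>
  define t where "t \<tau> = tstar - exp (- \<tau>)" for \<tau>
  have \<sigma>_lim: "(\<sigma> \<longlongrightarrow> 0) at_top"
    unfolding \<sigma>_def[abs_def] by (rule tendsto_exp_neg_mult_at_top[OF k])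
  have t_lim: "(t \<longlongrightarrow> tstar) at_top"
  proof -
    have "((\<lambda>\<tau>. tstar - exp (- \<tau> / 1)) \<longlongrightarrow> tstar - 0) at_top"
      by (intro tendsto_diff tendsto_const tendsto_exp_neg_mult_at_top) simp
    then show ?thesis by (simp add: t_def[abs_def])
  qed
  define g where "g \<tau> z = ?V (\<sigma> \<tau>, t \<tau>, Y0 + z) - fk (tstar, Y0) - ?J *v z" for \<tau> z
  obtain T1 where T1: "\<And>\<tau>. \<tau> \<ge> T1 \<Longrightarrow> \<sigma> \<tau> < p0"
    using order_tendstoD(2)[OF \<sigma>_lim p0] by (auto simp: eventually_at_top_linorder)
  have g_comp: "g \<tau> z $ i = \<sigma> \<tau> powr (k + real (\<alpha> i)) *
        f (t \<tau>, s_Lam \<alpha> (inverse (\<sigma> \<tau>)) (Y0 + z)) $ i - fk (tstar, Y0) $ i - (?J *v z) $ i"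
    if "\<tau> \<ge> T1" "z \<in> cball 0 \<rho>" for \<tau> z i
  proof -
    have "\<sigma> \<tau> < p_fun \<alpha> (Y0 + z)" using T1[OF that(1)] near(2)[OF that(2)] by linarith
    then show ?thesis unfolding g_def by (simp add: Vpos near[OF that(2)] \<sigma>_def)
  qed
  have "continuous_on ({T1..} \<times> cball 0 \<rho>) (\<lambda>(\<tau>, z). g \<tau> z)"
  proof -
    have "continuous_on ({T1..} \<times> cball 0 \<rho>) (\<lambda>w. f (t (fst w), s_Lam \<alpha> (inverse (\<sigma> (fst w))) (Y0 + snd w)))"
    proof (rule continuous_on_compose2[OF f])
      show "continuous_on ({T1..} \<times> cball 0 \<rho>) (\<lambda>w. (t (fst w), s_Lam \<alpha> (inverse (\<sigma> (fst w))) (Y0 + snd w)))"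
        unfolding t_def s_Lam_def \<sigma>_def
        by (intro continuous_on_Pair continuous_on_vec_lambda continuous_intros) (use k in auto)
      show "(\<lambda>w. (t (fst w), s_Lam \<alpha> (inverse (\<sigma> (fst w))) (Y0 + snd w))) ` ({T1..} \<times> cball 0 \<rho>) \<subseteq> UNIV \<times> U"
        using s_Lam_in_cylinder[OF cyl near(1)] by auto
    qed
    then have "continuous_on ({T1..} \<times> cball 0 \<rho>) (\<lambda>w. \<chi> i. \<sigma> (fst w) powr (k + real (\<alpha> i)) *
        f (t (fst w), s_Lam \<alpha> (inverse (\<sigma> (fst w))) (Y0 + snd w)) $ i - fk (tstar, Y0) $ i - (?J *v snd w) $ i)"
      unfolding \<sigma>_def
      by (intro continuous_on_vec_lambda continuous_on_diff continuous_on_mult continuous_on_const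
          continuous_on_powr continuous_on_component continuous_on_exp continuous_on_divide
          continuous_on_minus continuous_on_fst continuous_on_snd continuous_on_id
          linear_continuous_on_compose[OF continuous_on_snd] matrix_vector_mul_linear) (use k in auto)
    then show ?thesis
      by (rule continuous_on_eq) (auto simp: vec_eq_iff g_comp)
  qed
  moreover have "\<exists>T r. r > 0 \<and> (\<forall>\<tau>\<ge>T. \<forall>z\<in>cball 0 r. \<forall>z'\<in>cball 0 r. norm (g \<tau> z - g \<tau> z') \<le> e * norm (z - z'))"
    if e: "e > 0" for e
  proof -
    obtain d where d: "d > 0" "\<And>x y. x \<in> ball a d \<Longrightarrow> y \<in> ball a d \<Longrightarrow>
        norm (?V x - ?V y - L (x - y)) \<le> e * norm (x - y)"
      using has_strict_derivativeE[OF L e] by blast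
    have "\<forall>\<^sub>F \<tau> in at_top. dist (\<sigma> \<tau>) 0 < d / 3 \<and> dist (t \<tau>) tstar < d / 3"
      using d(1) by (intro eventually_conj tendstoD[OF \<sigma>_lim] tendstoD[OF t_lim]) auto
    then obtain T where T: "\<And>\<tau>. \<tau> \<ge> T \<Longrightarrow> dist (\<sigma> \<tau>) 0 < d / 3 \<and> dist (t \<tau>) tstar < d / 3"
      by (auto simp: eventually_at_top_linorder)
    have "norm (g \<tau> z - g \<tau> z') \<le> e * norm (z - z')"
      if \<tau>: "\<tau> \<ge> T" and z: "z \<in> cball 0 (d / 4)" "z' \<in> cball 0 (d / 4)" for \<tau> z z'
    proof -
      have in_ball: "(\<sigma> \<tau>, t \<tau>, Y0 + z) \<in> ball a d" if "z \<in> cball 0 (d / 4)" for z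
      proof -
        have "norm (\<sigma> \<tau>, t \<tau> - tstar, z) \<le> norm (\<sigma> \<tau>) + (norm (t \<tau> - tstar) + norm z)"
          by (intro order_trans[OF norm_Pair_le] add_left_mono norm_Pair_le)
        also have "\<dots> < d" using T[OF \<tau>] that d(1) by (auto simp: dist_norm)
        finally show ?thesis by (subst mem_ball, subst dist_commute) (simp add: a_def dist_norm)
      qed
      have "norm (?V (\<sigma> \<tau>, t \<tau>, Y0 + z) - ?V (\<sigma> \<tau>, t \<tau>, Y0 + z') - L (0, 0, z - z')) \<le> e * norm (z - z')"
        using d(2)[OF in_ball[OF z(1)] in_ball[OF z(2)]] by (simp add: norm_Pair)
      then show ?thesis by (simp add: g_def LJ matrix_vector_mult_diff_distrib algebra_simps)
    qed
    then show ?thesis using d(1) by (intro exI[of _ T] exI[of _ "d / 4"]) auto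
  qed
  moreover have "((\<lambda>\<tau>. g \<tau> 0) \<longlongrightarrow> 0) at_top"
  proof -
    have "((\<lambda>\<tau>. (\<sigma> \<tau>, t \<tau>, Y0)) \<longlongrightarrow> a) at_top"
      unfolding a_def by (intro tendsto_Pair \<sigma>_lim t_lim tendsto_const)
    then have "((\<lambda>\<tau>. ?V (\<sigma> \<tau>, t \<tau>, Y0)) \<longlongrightarrow> ?V a) at_top"
      by (rule isCont_tendsto_compose[OF strictly_differentiable_imp_isCont[OF V_sd]])
    moreover have "?V a = fk (tstar, Y0)" unfolding a_def by (rule V0[OF Y0])
    ultimately show ?thesis by (simp add: g_def LIM_zero)
  qed
  ultimately obtain z T2 where z: "(z \<longlongrightarrow> 0) at_top"
    and z': "\<And>\<tau>. \<tau> > T2 \<Longrightarrow> (z has_vector_derivative ?A *v z \<tau> + g \<tau> (z \<tau>)) (at \<tau>)"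
    using hyperbolic_asymptotic_equilibrium[OF hyp \<rho>, of T1 g] by blast
  obtain T3 where T3: "\<And>\<tau>. \<tau> \<ge> T3 \<Longrightarrow> norm (z \<tau>) < \<rho>"
    using tendstoD[OF z \<rho>] by (auto simp: eventually_at_top_linorder)
  define T where "T = max T1 (max T2 T3)"
  have in_cball: "z \<tau> \<in> cball 0 \<rho>" if "\<tau> > T" for \<tau>
    using T3[of \<tau>] that by (simp add: T_def)
  show ?thesis
  proof (rule that[of "\<lambda>\<tau>. Y0 + z \<tau>" T])
    show "((\<lambda>\<tau>. Y0 + z \<tau>) \<longlongrightarrow> Y0) at_top"
      using tendsto_add[OF tendsto_const z, of Y0] by simp
    show "Y0 + z \<tau> \<in> U" if "\<tau> > T" for \<tau>
      by (rule near(1)[OF in_cball[OF that]])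
    fix \<tau> i assume \<tau>: "\<tau> > T"
    have "((\<lambda>\<tau>. z \<tau> $ i) has_vector_derivative (?A *v z \<tau> + g \<tau> (z \<tau>)) $ i) (at \<tau>)"
      by (rule bounded_linear.has_vector_derivative[OF bounded_linear_vec_nth z'])
         (use \<tau> in \<open>simp add: T_def\<close>)
    then have "((\<lambda>\<tau>. (Y0 + z \<tau>) $ i) has_real_derivative (?A *v z \<tau> + g \<tau> (z \<tau>)) $ i) (at \<tau>)"
      unfolding has_real_derivative_iff_has_vector_derivative[symmetric]
      by (auto intro!: derivative_eq_intros)
    moreover have "fk (tstar, Y0) $ i = real (\<alpha> i) / k * Y0 $ i"
      using arg_cong[OF balance, of "\<lambda>v. v $ i"] by (simp add: Lam_mult_component)
    then have "(?A *v z \<tau> + g \<tau> (z \<tau>)) $ i = - (real (\<alpha> i) / k) * (Y0 + z \<tau>) $ i +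
        \<sigma> \<tau> powr (k + real (\<alpha> i)) * f (t \<tau>, s_Lam \<alpha> (inverse (\<sigma> \<tau>)) (Y0 + z \<tau>)) $ i"
      using \<tau> in_cball[OF \<tau>] unfolding vector_add_component
      by (subst g_comp) (simp_all add: T_def A_mat_mult Lam_mult_component algebra_simps)
    ultimately show "((\<lambda>\<tau>. (Y0 + z \<tau>) $ i) has_real_derivative
      - (real (\<alpha> i) / k) * (Y0 + z \<tau>) $ i + exp (- \<tau> / k) powr (k + real (\<alpha> i)) *
        f (tstar - exp (- \<tau>), s_Lam \<alpha> (inverse (exp (- \<tau> / k))) (Y0 + z \<tau>)) $ i) (at \<tau>)"
      by (simp add: \<sigma>_def t_def)
  qed
qed

theorem theorem3p23:
  fixes f fk :: "real \<times> (real ^ 'n::finite) \<Rightarrow> real ^ 'n"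
    and \<alpha> :: "'n \<Rightarrow> nat" and k :: real and U :: "(real ^ 'n) set" and r :: nat
    and tstar :: real and Y0 :: "real ^ 'n"
  assumes "\<exists>i. \<alpha> i \<noteq> 0"
    and "cylinder_domain \<alpha> U"
    and "r \<ge> 1"
    and "C_r_on r f (UNIV \<times> U)"
    and "asymp_quasi_homogeneous \<alpha> k U f fk"
    and "C_r_on 1 fk (UNIV \<times> {y \<in> U. \<exists>i\<in>I_of \<alpha>. y $ i \<noteq> 0})"
    and "tilde_extends r \<alpha> k U f"
    and "assumption_R \<alpha> k U f fk"
    and "Y0 \<in> U" and "Y0 \<noteq> 0"
    and "fk differentiable (at (tstar, Y0))"
    and "(- 1 / k) *\<^sub>R (Lam \<alpha> *v Y0) + fk (tstar, Y0) = 0"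
    and "Spec (A_mat \<alpha> k fk tstar Y0) \<inter> {z. Re z = 0} = {}"
  shows "\<exists>y. blow_up_solution f U y tstar \<and>
           (C_r_on 4 f (UNIV \<times> U) \<and> tilde_extends 4 \<alpha> k U f \<and>
            non_resonant (A_ext \<alpha> k fk tstar Y0) \<longrightarrow>
              (\<forall>i. Y0 $ i \<noteq> 0 \<longrightarrow>
                 (\<lambda>t. y t $ i) \<sim>[at_left tstar]
                   (\<lambda>t. Y0 $ i * (tstar - t) powr (- real (\<alpha> i) / k))))"
proof -
  note cyl = assms(2) and qh = assms(5)
  have k: "k > 0" using qh by (simp add: asymp_quasi_homogeneous_def)
  have "((\<lambda>y. (tstar, y)) has_derivative (\<lambda>v. (0, v))) (at Y0)"
    by (intro has_derivative_Pair has_derivative_const has_derivative_ident)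
  then have "(\<lambda>y. (tstar, y)) differentiable (at Y0)"
    by (rule differentiableI)
  then have diff: "(\<lambda>y. fk (tstar, y)) differentiable (at Y0)"
    using differentiable_chain_at[of "\<lambda>y. (tstar, y)" Y0 fk] assms(11) by (simp add: o_def)
  have p: "0 < p_fun \<alpha> Y0"
    using assms(13) by (intro hyperbolic_root_p_fun_pos[OF cyl qh assms(9,10) diff]) auto
  obtain Y T where lim: "(Y \<longlongrightarrow> Y0) at_top" and YU: "\<And>\<tau>. \<tau> > T \<Longrightarrow> Y \<tau> \<in> U"
    and Y': "\<And>\<tau> i. \<tau> > T \<Longrightarrow> ((\<lambda>\<tau>. Y \<tau> $ i) has_real_derivative
      - (real (\<alpha> i) / k) * Y \<tau> $ i + exp (- \<tau> / k) powr (k + real (\<alpha> i)) *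
        f (tstar - exp (- \<tau>), s_Lam \<alpha> (inverse (exp (- \<tau> / k))) (Y \<tau>)) $ i) (at \<tau>)"
    using rescaled_solution_exists[OF cyl assms(3) C_r_on_imp_continuous_on[OF assms(4)] qh
        C_r_on_imp_continuous_on[OF assms(6)] assms(7,8,9) p diff assms(12,13)] by blast
  \<comment> \<open>Undoing the rescaling. The factor \<open>(tstar - t) powr (- 1 / k)\<close> gives the blow-up, and also its rate,
    since \<open>Y\<close> tends to \<open>Y0\<close>.\<close>
  define y where "y t = s_Lam \<alpha> ((tstar - t) powr (- 1 / k)) (Y (- ln (tstar - t)))" for t
  have y_comp: "y t $ i = (tstar - t) powr (- real (\<alpha> i) / k) * Y (- ln (tstar - t)) $ i"
    if "t < tstar" for t i
    using that by (simp add: y_def s_Lam_def powr_powr flip: powr_realpow)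
  have ev: "\<forall>\<^sub>F t in at_left tstar. t < tstar"
    by (simp add: eventually_at_filter)
  have ln_lim: "filterlim (\<lambda>t. - ln (tstar - t)) at_top (at_left tstar)"
  proof -
    have "((\<lambda>t. tstar - t) \<longlongrightarrow> tstar - tstar) (at_left tstar)"
      by (intro tendsto_diff tendsto_const tendsto_ident_at)
    then have "filterlim (\<lambda>t. tstar - t) (at_right 0) (at_left tstar)"
      unfolding filterlim_at using ev by (auto elim: eventually_mono)
    then have "filterlim (\<lambda>t. ln (tstar - t)) at_bot (at_left tstar)"
      by (rule filterlim_compose[OF ln_at_0])
    then show ?thesis by (simp add: filterlim_uminus_at_top)
  qed
  have Y_lim: "((\<lambda>t. Y (- ln (tstar - t)) $ i) \<longlongrightarrow> Y0 $ i) (at_left tstar)" for i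
    by (rule filterlim_compose[OF tendsto_vec_nth[OF lim] ln_lim])
  have sol: "y t \<in> U \<and> (y has_vector_derivative f (t, y t)) (at t)"
    if t: "tstar - exp (- T) < t" "t < tstar" for t
  proof
    define \<theta> where "\<theta> = tstar - t"
    have \<theta>: "0 < \<theta>" "\<theta> < exp (- T)" using t by (auto simp: \<theta>_def)
    define \<tau> where "\<tau> = - ln \<theta>"
    have "ln \<theta> < ln (exp (- T))" using \<theta> by (subst ln_less_cancel_iff) auto
    then have \<tau>: "\<tau> > T" by (simp add: \<tau>_def)
    have exp_\<tau>: "exp (- \<tau>) = \<theta>" "exp (- \<tau> / k) = \<theta> powr (1 / k)"
      using \<theta> by (auto simp: \<tau>_def powr_def)
    have inv: "inverse (\<theta> powr (1 / k)) = \<theta> powr (- 1 / k)"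
      by (simp flip: powr_minus)
    have y_t: "y t = s_Lam \<alpha> (\<theta> powr (- 1 / k)) (Y \<tau>)" by (simp add: y_def \<theta>_def \<tau>_def)
    show "y t \<in> U" unfolding y_t by (intro s_Lam_in_cylinder[OF cyl] YU \<tau>)
    show "(y has_vector_derivative f (t, y t)) (at t)"
    proof (rule has_vector_derivative_vecI)
      fix i
      define b where "b = real (\<alpha> i) / k"
      define V where "V = \<theta> powr (1 + b) * f (t, y t) $ i"
      have pw: "(\<theta> powr (1 / k)) powr (k + real (\<alpha> i)) = \<theta> powr (1 + b)"
        using k by (simp add: powr_powr b_def field_simps)
      have Y'i: "((\<lambda>\<tau>. Y \<tau> $ i) has_real_derivative - b * Y \<tau> $ i + V) (at (- ln (tstar - t)))"
        using Y'[OF \<tau>, of i] unfolding exp_\<tau> inv y_t[symmetric] pw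
        by (simp add: V_def b_def \<theta>_def \<tau>_def)
      have "((\<lambda>t. - ln (tstar - t)) has_real_derivative 1 / \<theta>) (at t)"
        using \<theta> by (auto intro!: derivative_eq_intros simp: \<theta>_def)
      from DERIV_chain2[OF Y'i this]
      have 1: "((\<lambda>t. Y (- ln (tstar - t)) $ i) has_real_derivative (- b * Y \<tau> $ i + V) * (1 / \<theta>)) (at t)" .
      have 2: "((\<lambda>t. (tstar - t) powr (- b)) has_real_derivative b * \<theta> powr (- b - 1)) (at t)"
        using \<theta> unfolding \<theta>_def
        by (auto intro!: derivative_eq_intros simp: powr_diff)
      from DERIV_mult[OF 2 1]
      have "((\<lambda>t. (tstar - t) powr (- b) * Y (- ln (tstar - t)) $ i) has_real_derivative
          b * \<theta> powr (- b - 1) * Y \<tau> $ i + (- b * Y \<tau> $ i + V) * (1 / \<theta>) * \<theta> powr (- b)) (at t)"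
        by (simp add: \<theta>_def \<tau>_def)
      also have "b * \<theta> powr (- b - 1) * Y \<tau> $ i + (- b * Y \<tau> $ i + V) * (1 / \<theta>) * \<theta> powr (- b) =
          \<theta> powr (- b - 1) * V"
        using \<theta> by (simp add: powr_diff field_simps)
      also have "\<theta> powr (- b - 1) * V = f (t, y t) $ i"
        using \<theta> by (simp add: V_def flip: mult.assoc powr_add)
      finally have "((\<lambda>t. (tstar - t) powr (- b) * Y (- ln (tstar - t)) $ i) has_real_derivative f (t, y t) $ i) (at t)" .
      then show "((\<lambda>t. y t $ i) has_real_derivative f (t, y t) $ i) (at t)"
        by (rule has_field_derivative_transform_within_open[where S = "{..<tstar}"])
           (use t in \<open>auto simp: y_comp b_def\<close>)
    qed
  qed
  have asymp: "(\<lambda>t. y t $ i) \<sim>[at_left tstar] (\<lambda>t. Y0 $ i * (tstar - t) powr (- real (\<alpha> i) / k))"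
    if "Y0 $ i \<noteq> 0" for i
  proof (rule asymp_equivI')
    have "((\<lambda>t. Y (- ln (tstar - t)) $ i / Y0 $ i) \<longlongrightarrow> Y0 $ i / Y0 $ i) (at_left tstar)"
      by (intro tendsto_divide Y_lim tendsto_const that)
    then have "((\<lambda>t. Y (- ln (tstar - t)) $ i / Y0 $ i) \<longlongrightarrow> 1) (at_left tstar)"
      using that by simp
    then show "((\<lambda>t. y t $ i / (Y0 $ i * (tstar - t) powr (- real (\<alpha> i) / k))) \<longlongrightarrow> 1) (at_left tstar)"
      proof (rule Lim_transform_eventually)
      show "\<forall>\<^sub>F t in at_left tstar. Y (- ln (tstar - t)) $ i / Y0 $ i =
          y t $ i / (Y0 $ i * (tstar - t) powr (- real (\<alpha> i) / k))"
        using ev by eventually_elim (simp add: y_comp)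
    qed
  qed
  have "filterlim (\<lambda>t. norm (y t)) at_top (at_left tstar)"
  proof -
    obtain i where i: "i \<in> I_of \<alpha>" "Y0 $ i \<noteq> 0" using p by (auto simp: p_fun_pos_iff)
    have "real (\<alpha> i) / k > 0" using i k by (simp add: I_of_def)
    then have "filterlim (\<lambda>t. exp (real (\<alpha> i) / k * - ln (tstar - t))) at_top (at_left tstar)"
      by (intro filterlim_compose[OF exp_at_top] filterlim_tendsto_pos_mult_at_top[OF tendsto_const _ ln_lim])
    moreover have "\<forall>\<^sub>F t in at_left tstar. exp (real (\<alpha> i) / k * - ln (tstar - t)) = (tstar - t) powr (- real (\<alpha> i) / k)"
      using ev by eventually_elim (simp add: powr_def)
    ultimately have "filterlim (\<lambda>t. (tstar - t) powr (- real (\<alpha> i) / k)) at_top (at_left tstar)"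
      using filterlim_cong by fast
    then have "filterlim (\<lambda>t. \<bar>Y (- ln (tstar - t)) $ i\<bar> * (tstar - t) powr (- real (\<alpha> i) / k)) at_top (at_left tstar)"
      using i by (intro filterlim_tendsto_pos_mult_at_top[OF tendsto_rabs[OF Y_lim]]) auto
    then show ?thesis
    proof (rule filterlim_at_top_mono)
      show "\<forall>\<^sub>F t in at_left tstar. \<bar>Y (- ln (tstar - t)) $ i\<bar> * (tstar - t) powr (- real (\<alpha> i) / k) \<le> norm (y t)"
        using ev
      proof eventually_elim
        case (elim t)
        have "\<bar>y t $ i\<bar> \<le> norm (y t)" by (rule component_le_norm_cart)
        then show ?case by (simp add: y_comp[OF elim] abs_mult mult.commute)
      qed
    qed
  qed
  moreover have "tstar - exp (- T) < tstar" by simp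
  ultimately have "blow_up_solution f U y tstar"
    unfolding blow_up_solution_def using sol by (intro conjI exI[of _ "tstar - exp (- T)"]) auto
  with asymp show ?thesis by blast
qed

end
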